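(* Let $\mathcal{X}$ be a Polish space. Suppose $\mathcal{L}:\mathcal{X}\to[-\infty,\infty)$ is measurable and either bounded below or bounded above, $P\in\mathcal{P}(\mathcal{X})$, $D$ is a pre-divergence such that $Q\mapsto D(Q\|P)$ is convex, and $c$ is a cost function with $c(x,x)=0$ for all $x\in\mathcal{X}$. Then for every $\lambda>0$ the function $\mathcal{L}^c_\lambda$ is universally measurable and \[ \sup_{Q\in\mathcal{P}(\mathcal{X}): D^c(Q\|P)<\infty}\{E_Q[\mathcal{L}]-\lambda D^c(Q\|P)\}=\sup_{Q\in\mathcal{P}(\mathcal{X}):D(Q\|P)<\infty}\{ E_{Q}[ \lambda\mathcal{L}_\lambda^c]- \lambda D(Q\|P)\}. \]
   Context: $\mathcal{X}$ is a Polish space with Borel $\sigma$-algebra; $\mathcal{P}(\mathcal{X})$ denotes the Borel probability measures. A pre-divergence is $D:\mathcal{P}(\mathcal{X})\times\mathcal{P}(\mathcal{X})\to[0,\infty]$ with $D(\mu\|\mu)=0$ for all $\mu$. A cost function is a lower semicontinuous $c:\mathcal{X}\times\mathcal{X}\to[0,\infty]$, with OT cost $C(\mu,\nu)=\inf\{\int c\,d\pi:\pi\in\mathcal{P}(\mathcal{X}\times\mathcal{X}),\pi_1=\mu,\pi_2=\nu\}$. $D^c(\nu\|\mu)=\inf_{\eta\in\mathcal{P}(\mathcal{X})}\{D(\eta\|\mu)+C(\eta,\nu)\}$. For $\lambda>0$, $\mathcal{L}^c_\lambda(x)=\sup_{y\in\mathcal{X}}\{\mathcal{L}(y)/\lambda-c(x,y)\}$;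 its expectation under $Q$ is taken with respect to the completion of $Q$. *)

theory Defs
  imports "HOL-Analysis.Analysis" "HOL-Probability.Probability"
begin

definition prob_measures :: "'a::topological_space measure set" where
  "prob_measures = {Q. sets Q = sets borel \<and> prob_space Q}"

definition pre_divergence :: "('a::topological_space measure \<Rightarrow> 'a measure \<Rightarrow> ennreal) \<Rightarrow> bool" where
  "pre_divergence D \<longleftrightarrow> (\<forall>\<mu>\<in>prob_measures. D \<mu> \<mu> = 0)"

definition mixture :: "real \<Rightarrow> 'a::topological_space measure \<Rightarrow> 'a measure \<Rightarrow> 'a measure" where
  "mixture t Q1 Q2 = measure_of (space borel) (sets borel)
     (\<lambda>A. ennreal t * emeasure Q1 A + ennreal (1 - t) * emeasure Q2 A)"

definition convex_on_prob :: "('a::topological_space measure \<Rightarrow> ennreal) \<Rightarrow> bool" where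
  "convex_on_prob F \<longleftrightarrow> (\<forall>Q1\<in>prob_measures. \<forall>Q2\<in>prob_measures. \<forall>t::real. 0 \<le> t \<and> t \<le> 1 \<longrightarrow>
      F (mixture t Q1 Q2) \<le> ennreal t * F Q1 + ennreal (1 - t) * F Q2)"

definition lower_semicont :: "('b::topological_space \<Rightarrow> ereal) \<Rightarrow> bool" where
  "lower_semicont f \<longleftrightarrow> (\<forall>t. open {x. t < f x})"

definition cost_function :: "('a::topological_space \<Rightarrow> 'a \<Rightarrow> ereal) \<Rightarrow> bool" where
  "cost_function c \<longleftrightarrow> lower_semicont (\<lambda>(x,y). c x y) \<and> (\<forall>x y. 0 \<le> c x y)"

definition couplings :: "'a::topological_space measure \<Rightarrow> 'a measure \<Rightarrow> ('a \<times> 'a) measure set" where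
  "couplings \<mu> \<nu> = {\<pi>\<in>prob_measures. distr \<pi> borel fst = \<mu> \<and> distr \<pi> borel snd = \<nu>}"

definition OT_cost :: "('a::topological_space \<Rightarrow> 'a \<Rightarrow> ereal) \<Rightarrow> 'a measure \<Rightarrow> 'a measure \<Rightarrow> ennreal" where
  "OT_cost c \<mu> \<nu> = (INF \<pi>\<in>couplings \<mu> \<nu>. \<integral>\<^sup>+ p. e2ennreal (c (fst p) (snd p)) \<partial>\<pi>)"

definition OT_reg_div ::
  "('a::topological_space measure \<Rightarrow> 'a measure \<Rightarrow> ennreal) \<Rightarrow> ('a \<Rightarrow> 'a \<Rightarrow> ereal) \<Rightarrow> 'a measure \<Rightarrow> 'a measure \<Rightarrow> ennreal" where
  "OT_reg_div D c \<nu> \<mu> = (INF \<eta>\<in>prob_measures. D \<eta> \<mu> + OT_cost c \<eta> \<nu>)"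

definition L_c :: "('a \<Rightarrow> ereal) \<Rightarrow> ('a \<Rightarrow> 'a \<Rightarrow> ereal) \<Rightarrow> real \<Rightarrow> 'a \<Rightarrow> ereal" where
  "L_c L c lam x = (SUP y. L y / ereal lam - c x y)"

definition universally_measurable :: "('a::topological_space \<Rightarrow> ereal) \<Rightarrow> bool" where
  "universally_measurable f \<longleftrightarrow> (\<forall>\<mu>\<in>prob_measures. f \<in> borel_measurable (completion \<mu>))"

definition ereal_expect :: "'a measure \<Rightarrow> ('a \<Rightarrow> ereal) \<Rightarrow> ereal" where
  "ereal_expect Q f = enn2ereal (\<integral>\<^sup>+ x. e2ennreal (f x) \<partial>Q) - enn2ereal (\<integral>\<^sup>+ x. e2ennreal (- f x) \<partial>Q)"

end

(* The bound "lhs \<le> rhs" is integration of L(y) - \<lambda> c(x,y) \<le> \<lambda> L_c(x) against a coupling.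
   For the converse a Borel map f with L(f x) - \<lambda> c(x, f x) close to \<lambda> L_c(x) is needed: then
   Q and its image under f are coupled by the graph of f, at cost E_Q[c(x, f x)]. Such maps, and the universal
   measurability of L_c, come from one uniformization result: for Borel B in X \<times> Y and a finite
   Borel measure Q there is a Borel map whose graph lies in B over Q-almost all of the projection of B.
   It is proved by writing B as the projection of a closed subset of (X \<times> Y) \<times> N^N,
   approximating the outer measure of the projection from inside by projections of the part over a compact set
   (as in Choquet's capacitability theorem), and selecting over that compact set by successive refinement.
   Since c(x,x) = 0, where f would make the transport cost non-integrable one can keep the point x fixed. *)

theory Submission
  imports Defs
begin

section \<open>Borel sets as projections of closed sets\<close>

text \<open>The supremum over \<open>y\<close> in \<open>L_c\<close> is uncountable: its superlevel
  sets are projections of Borel sets and need not be Borel. The transform is therefore always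
  handled relative to one fixed measure and up to a null set, where it equals a countable supremum
  along Borel maps; universal measurability follows because the measure is arbitrary. A second
  obstacle is the subtraction of infinities. \<open>ereal_expect\<close> is a difference of two
  possibly infinite integrals, and \<infinity> - \<infinity> is \<infinity> in \<open>ereal\<close>,
  so the expectation of \<open>L\<close> minus a cost is split only when the cost is integrable and
  one of the two parts of \<open>L\<close> is. Selections must therefore come with finite cost, and
  the two boundedness hypotheses get different ones: for \<open>L\<close> bounded below a running
  argmax combined with monotone convergence, for \<open>L\<close> bounded above an
  \<epsilon>-optimal choice whose cost is dominated by the negative part of the transform.\<close>

definition suslin :: "'z::topological_space set \<Rightarrow> bool" where
  "suslin B \<longleftrightarrow> (\<exists>F :: ('z \<times> (nat \<Rightarrow> nat discrete)) set. closed F \<and> B = fst ` F)"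

lemma suslin_closed: "closed S \<Longrightarrow> suslin S"
  unfolding suslin_def by (intro exI[of _ "S \<times> UNIV"]) (auto simp: closed_Times)

lemma continuous_on_reindex:
  "continuous_on UNIV (\<lambda>s::'i \<Rightarrow> 'a::topological_space. (\<lambda>j. s (f j)))"
  by (intro continuous_on_coordinatewise_then_product continuous_on_product_coordinates)

text \<open>The entry at 0 of the sequence names the index \<open>n\<close>, and the shifted tail is
  a witness for membership in \<open>B n\<close>. The type \<open>nat discrete\<close> gives each
  coordinate the discrete topology, so the sequences form Baire space.\<close>

lemma suslin_UN:
  assumes "\<And>n::nat. suslin (B n)"
  shows "suslin (\<Union>n. B n)"
proof -
  obtain F :: "nat \<Rightarrow> ('a \<times> (nat \<Rightarrow> nat discrete)) set"
    where F: "\<And>n. closed (F n)" "\<And>n. B n = fst ` F n"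
    using assms unfolding suslin_def by metis
  define G where "G n = {p :: 'a \<times> (nat \<Rightarrow> nat discrete). (fst p, \<lambda>i. snd p (Suc i)) \<in> F n}" for n
  define H where "H = {p :: 'a \<times> (nat \<Rightarrow> nat discrete). p \<in> G (of_discrete (snd p 0))}"
  have G: "closed (G n)" for n
  proof -
    have "continuous_on UNIV (\<lambda>p :: 'a \<times> (nat \<Rightarrow> nat discrete). (fst p, \<lambda>i. snd p (Suc i)))"
      by (intro continuous_intros continuous_on_compose2[OF continuous_on_reindex]) auto
    from closed_vimage[OF F(1)[of n] this] show ?thesis
      by (simp add: G_def vimage_def)
  qed
  have cont0: "continuous_on UNIV (\<lambda>p :: 'a \<times> (nat \<Rightarrow> nat discrete). snd p 0)"
    by (rule continuous_on_compose2[OF continuous_on_product_coordinates[where i = 0]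
          continuous_on_snd[OF continuous_on_id]]) auto
  \<comment> \<open>The first coordinate is locally constant, so the complement of \<open>H\<close>
    is a union of open pieces, one for each value of that coordinate. The union of the sets
    \<open>F n\<close> themselves need not be closed.\<close>
  have "- H = (\<Union>n. - G n \<inter> (\<lambda>p. snd p 0) -` {discrete n})"
    by (auto simp: H_def of_discrete_inverse discrete_inverse)
  also have "open \<dots>"
    using G by (intro open_UN ballI open_Int open_vimage open_discrete cont0) auto
  finally have "closed H" by (simp add: closed_def)
  moreover have "(\<Union>n. B n) = fst ` H"
  proof (intro equalityI subsetI)
    fix z assume "z \<in> (\<Union>n. B n)"
    then obtain n where "z \<in> B n" by blast
    then obtain s where "(z, s) \<in> F n" unfolding F(2) by (elim imageE) (metis surjective_pairing)
    then have "(z, case_nat (discrete n) s) \<in> H"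
      by (simp add: H_def G_def discrete_inverse)
    from imageI[OF this, of fst] show "z \<in> fst ` H" by simp
  next
    fix z assume "z \<in> fst ` H"
    then obtain s where "(z, s) \<in> H" by auto
    then have "(z, \<lambda>i. s (Suc i)) \<in> F (of_discrete (s 0))" by (simp add: H_def G_def)
    from imageI[OF this, of fst] have "z \<in> B (of_discrete (s 0))" by (simp add: F(2))
    then show "z \<in> (\<Union>n. B n)" by blast
  qed
  ultimately show ?thesis unfolding suslin_def by blast
qed

text \<open>One sequence encodes countably many through \<open>prod_encode\<close>: its
  \<open>n\<close>-th subsequence is the witness for \<open>B n\<close>, so the conditions for
  different \<open>n\<close> do not interfere and remain closed.\<close>

lemma suslin_INT:
  assumes "\<And>n::nat. suslin (B n)"
  shows "suslin (\<Inter>n. B n)"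
proof -
  obtain F :: "nat \<Rightarrow> ('a \<times> (nat \<Rightarrow> nat discrete)) set"
    where F: "\<And>n. closed (F n)" "\<And>n. B n = fst ` F n"
    using assms unfolding suslin_def by metis
  define G where "G n = {p :: 'a \<times> (nat \<Rightarrow> nat discrete). (fst p, \<lambda>i. snd p (prod_encode (n, i))) \<in> F n}" for n
  have "closed (G n)" for n
  proof -
    have "continuous_on UNIV (\<lambda>p :: 'a \<times> (nat \<Rightarrow> nat discrete). (fst p, \<lambda>i. snd p (prod_encode (n, i))))"
      by (intro continuous_intros continuous_on_compose2[OF continuous_on_reindex]) auto
    from closed_vimage[OF F(1)[of n] this] show ?thesis
      by (simp add: G_def vimage_def)
  qed
  then have "closed (\<Inter>n. G n)" by auto
  moreover have "(\<Inter>n. B n) = fst ` (\<Inter>n. G n)"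
  proof (intro equalityI subsetI)
    fix z assume "z \<in> (\<Inter>n. B n)"
    then have "\<forall>n. \<exists>s. (z, s) \<in> F n" using F(2) by fastforce
    then obtain s where s: "\<And>n. (z, s n) \<in> F n" by metis
    have "(z, \<lambda>m. case prod_decode m of (n, i) \<Rightarrow> s n i) \<in> (\<Inter>n. G n)"
      using s by (simp add: G_def)
    then show "z \<in> fst ` (\<Inter>n. G n)" by force
  next
    fix z assume "z \<in> fst ` (\<Inter>n. G n)"
    then show "z \<in> (\<Inter>n. B n)" unfolding G_def F(2) by force
  qed
  ultimately show ?thesis unfolding suslin_def by blast
qed

lemma suslin_open:
  fixes U :: "'a::metric_space set"
  assumes "open U"
  shows "suslin U"
\<comment> \<open>\<open>infdist\<close> to the empty set is 0, so the description of
  \<open>U\<close> by distances to its complement fails exactly for \<open>U = UNIV\<close>.\<close>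
proof (cases "U = UNIV")
  case True
  then show ?thesis by (simp add: suslin_closed)
next
  case False
  have "closed {x. 1 / real (Suc n) \<le> infdist x (- U)}" for n
    by (intro closed_Collect_le continuous_intros)
  moreover have "U = (\<Union>n. {x. 1 / real (Suc n) \<le> infdist x (- U)})"
  proof (intro equalityI subsetI)
    fix x assume "x \<in> U"
    then have "infdist x (- U) > 0"
      using assms False by (intro infdist_pos_not_in_closed) auto
    then obtain n where "1 / real (Suc n) < infdist x (- U)" by (rule nat_approx_posE)
    then show "x \<in> (\<Union>n. {x. 1 / real (Suc n) \<le> infdist x (- U)})"
      by (intro UN_I[of n]) simp_all
  next
    fix x assume "x \<in> (\<Union>n. {x. 1 / real (Suc n) \<le> infdist x (- U)})"
    then obtain n where n: "1 / real (Suc n) \<le> infdist x (- U)" by auto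
    moreover have "0 < 1 / real (Suc n)" by simp
    ultimately have "infdist x (- U) > 0" by linarith
    then show "x \<in> U" using infdist_zero[of x "- U"] by (metis ComplI less_irrefl)
  qed
  ultimately show ?thesis by (metis suslin_UN suslin_closed)
qed

text \<open>Projections of closed sets are not stable under complement. The induction therefore
  carries a set together with its complement: complementation swaps the two, and a countable union
  needs closure under unions and intersections at once.\<close>

lemma suslin_borel:
  fixes B :: "'a::metric_space set"
  assumes "B \<in> sets borel"
  shows "suslin B"
proof -
  have "B \<in> sigma_sets UNIV {S. closed S}"
    using assms by (simp add: borel_eq_closed)
  then have "suslin B \<and> suslin (- B)"
  proof induction
    case (Basic a)
    then show ?case by (auto simp: suslin_closed intro!: suslin_open)
  next
    case Empty
    then show ?case by (simp add: suslin_closed)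
  next
    case (Compl a)
    then show ?case by (simp add: Compl_eq_Diff_UNIV[symmetric])
  next
    case (Union a)
    then show ?case by (simp add: suslin_UN suslin_INT)
  qed
  then show ?thesis ..
qed

section \<open>Compactness and projections along compact sets\<close>

lemma compact_if_small_covers:
  fixes S :: "'a::complete_space set"
  assumes "closed S" "\<And>e::real. e > 0 \<Longrightarrow> \<exists>N. finite N \<and> S \<subseteq> (\<Union>x\<in>N. cball x e)"
  shows "compact S"
proof (subst compact_eq_totally_bounded, intro conjI allI impI)
  fix e :: real assume "e > 0"
  then obtain N where N: "finite N" "S \<subseteq> (\<Union>x\<in>N. cball x (e / 2))"
    using assms(2)[of "e / 2"] by auto
  have "(\<Union>x\<in>N. cball x (e / 2)) \<subseteq> (\<Union>x\<in>N. ball x e)"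
    using \<open>e > 0\<close> by (intro UN_mono) auto
  with N show "\<exists>k. finite k \<and> S \<subseteq> (\<Union>x\<in>k. ball x e)" by (intro exI[of _ N] conjI) (rule N(1), rule subset_trans)
qed (use assms(1) in \<open>simp add: complete_eq_closed\<close>)

text \<open>A convergent sequence in the projection has witnesses in \<open>C\<close>, of which a
  subsequence converges. This makes the sets that approximate a projection closed, hence measurable,
  while the projection itself need not even be Borel.\<close>

lemma closed_proj_compact:
  fixes F :: "('a::metric_space \<times> 'b::metric_space) set"
  assumes "closed F" "compact C"
  shows "closed (fst ` (F \<inter> UNIV \<times> C))"
  unfolding closed_sequential_limits
proof safe
  fix X x assume X: "\<forall>n. X n \<in> fst ` (F \<inter> UNIV \<times> C)" "X \<longlonglongrightarrow> x"
  then have "\<forall>n. \<exists>w. w \<in> C \<and> (X n, w) \<in> F" by force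
  then obtain w where w: "\<And>n. w n \<in> C" "\<And>n. (X n, w n) \<in> F" by metis
  obtain l r where l: "l \<in> C" "strict_mono (r :: nat \<Rightarrow> nat)" "(w \<circ> r) \<longlonglongrightarrow> l"
    using assms(2) w(1) unfolding compact_def by metis
  have "(\<lambda>n. (X (r n), w (r n))) \<longlonglongrightarrow> (x, l)"
    using l(3) LIMSEQ_subseq_LIMSEQ[OF X(2) l(2)] by (intro tendsto_Pair) (auto simp: o_def)
  with assms(1) w(2) have "(x, l) \<in> F" by (metis (no_types, lifting) closed_sequentially)
  with l(1) show "x \<in> fst ` (F \<inter> UNIV \<times> C)" by force
qed

text \<open>The sets \<open>T k\<close> need not be compact, so their projections need not be
  closed, but only the limit matters. Points of \<open>F\<close> over \<open>T k\<close> whose first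
  coordinates approach \<open>x\<close> have second coordinates covered by finitely many balls of
  every size; a limit point of these lies in every \<open>T k\<close>.\<close>

lemma proj_INT_small_covers:
  fixes F :: "('a::metric_space \<times> 'b::complete_space) set"
  assumes F: "closed F" and T: "\<And>k. closed (T k)" "decseq T"
    and cover: "\<And>k::nat. \<exists>N. finite N \<and> T k \<subseteq> (\<Union>x\<in>N. cball x (1 / 2 ^ k))"
  shows "compact (\<Inter>k. T k)"
    and "(\<Inter>k. closure (fst ` (F \<inter> UNIV \<times> T k))) \<subseteq> fst ` (F \<inter> UNIV \<times> (\<Inter>k. T k))"
proof -
  have small: "\<exists>k. (1/2) ^ k < e" if "e > 0" for e :: real
    using real_arch_pow_inv[of e "1/2"] that by auto
  show "compact (\<Inter>k. T k)"
  proof (rule compact_if_small_covers)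
    fix e :: real assume "e > 0"
    then obtain k where k: "(1/2) ^ k < e" using small by blast
    obtain N where N: "finite N" "T k \<subseteq> (\<Union>x\<in>N. cball x (1 / 2 ^ k))" using cover by blast
    have "cball x (1 / 2 ^ k) \<subseteq> cball x e" for x :: 'b
      using k by (intro subset_cball) (simp add: power_one_over)
    with N show "\<exists>N. finite N \<and> (\<Inter>k. T k) \<subseteq> (\<Union>x\<in>N. cball x e)" by (intro exI[of _ N]) blast
  qed (use T in auto)
  show "(\<Inter>k. closure (fst ` (F \<inter> UNIV \<times> T k))) \<subseteq> fst ` (F \<inter> UNIV \<times> (\<Inter>k. T k))"
  proof
    fix x assume x: "x \<in> (\<Inter>k. closure (fst ` (F \<inter> UNIV \<times> T k)))"
    have "\<exists>p. p \<in> F \<and> snd p \<in> T k \<and> dist (fst p) x < (1/2) ^ k" for k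
    proof -
      have "x \<in> closure (fst ` (F \<inter> UNIV \<times> T k))" using x by auto
      then obtain y where "y \<in> fst ` (F \<inter> UNIV \<times> T k)" "dist y x < (1/2) ^ k"
        unfolding closure_approachable by (meson half_gt_zero_iff zero_less_one zero_less_power)
      then show ?thesis by force
    qed
    then obtain p where p: "\<And>k. p k \<in> F" "\<And>k. snd (p k) \<in> T k"
      "\<And>k. dist (fst (p k)) x < (1/2) ^ k" by metis
    have fst_lim: "(\<lambda>k. fst (p k)) \<longlonglongrightarrow> x"
    proof (subst tendsto_dist_iff, rule tendsto_sandwich[OF _ _ tendsto_const])
      show "(\<lambda>k. (1/2::real) ^ k) \<longlonglongrightarrow> 0" by (rule LIMSEQ_power_zero) simp
    qed (auto intro: always_eventually less_imp_le[OF p(3)])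
    have "compact (closure (range (\<lambda>k. snd (p k))))"
    proof (rule compact_if_small_covers)
      fix e :: real assume "e > 0"
      then obtain k where k: "(1/2) ^ k < e" using small by blast
      obtain N where N: "finite N" "T k \<subseteq> (\<Union>x\<in>N. cball x (1 / 2 ^ k))" using cover by blast
      have sub: "cball x (1 / 2 ^ k) \<subseteq> cball x e" for x :: 'b
        using k by (intro subset_cball) (simp add: power_one_over)
      \<comment> \<open>The first \<open>k\<close> points may lie outside \<open>T k\<close>; each
        is covered by a ball around itself.\<close>
      let ?N = "N \<union> (\<lambda>j. snd (p j)) ` {..<k}"
      have "snd (p j) \<in> (\<Union>x\<in>?N. cball x e)" for j
      proof (cases "j < k")
        case True
        then show ?thesis using \<open>e > 0\<close> by (intro UN_I[of "snd (p j)"]) auto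
      next
        case False
        then have "snd (p j) \<in> T k" using decseqD[OF T(2), of k j] p(2)[of j] by auto
        then show ?thesis using N(2) sub by blast
      qed
      moreover have "closed (\<Union>x\<in>?N. cball x e)" using N(1) by (intro closed_UN) auto
      ultimately have "closure (range (\<lambda>k. snd (p k))) \<subseteq> (\<Union>x\<in>?N. cball x e)"
        by (intro closure_minimal image_subsetI)
      with N(1) show "\<exists>N. finite N \<and> closure (range (\<lambda>k. snd (p k))) \<subseteq> (\<Union>x\<in>N. cball x e)"
        by (intro exI[of _ ?N]) auto
    qed simp
    moreover have "\<forall>k. snd (p k) \<in> closure (range (\<lambda>k. snd (p k)))"
      using closure_subset by fastforce
    ultimately obtain l r where l: "strict_mono (r :: nat \<Rightarrow> nat)" "((\<lambda>k. snd (p k)) \<circ> r) \<longlonglongrightarrow> l"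
      unfolding compact_def by metis
    have lim: "(\<lambda>n. (fst (p (r n)), snd (p (r n)))) \<longlonglongrightarrow> (x, l)"
      using l(2) LIMSEQ_subseq_LIMSEQ[OF fst_lim l(1)] by (intro tendsto_Pair) (auto simp: o_def)
    have "(x, l) \<in> F" by (rule closed_sequentially[OF F _ lim]) (simp add: p(1))
    moreover have "l \<in> T k" for k
    proof (rule Lim_in_closed_set[OF T(1) _ _ l(2)])
      show "\<forall>\<^sub>F n in sequentially. ((\<lambda>k. snd (p k)) \<circ> r) n \<in> T k"
      proof (rule eventually_sequentiallyI[of k])
        fix n assume "k \<le> n"
        then have "k \<le> r n" using seq_suble[OF l(1), of n] by linarith
        then show "((\<lambda>k. snd (p k)) \<circ> r) n \<in> T k"
          using decseqD[OF T(2), of k "r n"] p(2)[of "r n"] by auto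
      qed
    qed simp
    ultimately show "x \<in> fst ` (F \<inter> UNIV \<times> (\<Inter>k. T k))" by force
  qed
qed

section \<open>Measurable uniformization\<close>

lemma countable_dense_sequence:
  obtains d :: "nat \<Rightarrow> 'a::{metric_space, second_countable_topology}"
    where "\<And>w e. e > 0 \<Longrightarrow> \<exists>i. dist (d i) w \<le> e"
proof -
  obtain D :: "'a set" where D: "countable D" "\<And>X. open X \<Longrightarrow> X \<noteq> {} \<Longrightarrow> \<exists>d\<in>D. d \<in> X"
    using countable_dense_exists by blast
  have "D \<noteq> {}" using D(2)[of UNIV] by auto
  show ?thesis
  proof
    fix w :: 'a and e :: real assume "e > 0"
    then obtain v where v: "v \<in> D" "v \<in> ball w e" using D(2)[of "ball w e"] by auto
    obtain i where "from_nat_into D i = v"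
      using from_nat_into_surj[OF D(1) v(1)] by auto
    then show "\<exists>i. dist (from_nat_into D i) w \<le> e"
      using v(2) by (intro exI[of _ i]) (simp add: dist_commute)
  qed
qed

lemma projection_inner_compact:
  fixes F :: "('a::metric_space \<times> 'b::{complete_space, second_countable_topology}) set"
  assumes Q: "finite_measure Q" "sets Q = sets borel" and F: "closed F"
    and a: "a < outer_measure_of Q (fst ` F)"
  shows "\<exists>C. compact C \<and> a \<le> emeasure Q (fst ` (F \<inter> UNIV \<times> C))"
proof -
  interpret finite_measure Q by fact
  have space: "space Q = UNIV" using sets_eq_imp_space_eq[OF Q(2)] by simp
  define \<mu> where "\<mu> T = outer_measure_of Q (fst ` (F \<inter> UNIV \<times> T))" for T
  obtain d :: "nat \<Rightarrow> 'b" where d: "\<And>w e. e > 0 \<Longrightarrow> \<exists>i. dist (d i) w \<le> e"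
    using countable_dense_sequence by blast
  \<comment> \<open>Shrink to finitely many small balls at each stage. The outer measure is continuous along increasing
    sequences of arbitrary sets, so the strict bound by \<open>a\<close> can be preserved.\<close>
  define P where "P k T \<longleftrightarrow> closed T \<and> (\<exists>N. finite N \<and> T \<subseteq> (\<Union>x\<in>N. cball x (1 / 2 ^ k))) \<and> a < \<mu> T"
    for k :: nat and T :: "'b set"
  have step: "\<exists>T'. P k T' \<and> T' \<subseteq> T" if T: "closed T" "a < \<mu> T" for k T
  proof -
    define T' where "T' n = T \<inter> (\<Union>i<n. cball (d i) (1 / 2 ^ k))" for n
    have "(\<Union>n. T' n) = T"
    proof (intro equalityI subsetI)
      fix w assume "w \<in> T"
      moreover obtain i where "dist (d i) w \<le> 1 / 2 ^ k" using d[of "1 / 2 ^ k"] by auto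
      ultimately have "w \<in> T' (Suc i)" by (auto simp: T'_def)
      then show "w \<in> (\<Union>n. T' n)" by blast
    qed (auto simp: T'_def)
    then have "fst ` (F \<inter> UNIV \<times> T) = (\<Union>n. fst ` (F \<inter> UNIV \<times> T' n))" by blast
    moreover have "incseq (\<lambda>n. fst ` (F \<inter> UNIV \<times> T' n))"
      unfolding incseq_def T'_def by (intro allI impI image_mono Int_mono Sigma_mono UN_mono) auto
    then have "(SUP n. outer_measure_of Q (fst ` (F \<inter> UNIV \<times> T' n))) = outer_measure_of Q (\<Union>n. fst ` (F \<inter> UNIV \<times> T' n))"
      by (intro SUP_outer_measure_of_incseq) (simp add: space)
    ultimately have "a < (SUP n. \<mu> (T' n))" using T(2) by (simp add: \<mu>_def)
    then obtain n where "a < \<mu> (T' n)" by (auto simp: less_SUP_iff)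
    moreover have "closed (T' n)"
      unfolding T'_def using T(1) by (intro closed_Int closed_UN) auto
    moreover have "T' n \<subseteq> (\<Union>x\<in>d ` {..<n}. cball x (1 / 2 ^ k))"
      unfolding T'_def by blast
    ultimately show ?thesis
      unfolding P_def by (intro exI[of _ "T' n"] conjI exI[of _ "d ` {..<n}"]) (auto simp: T'_def)
  qed
  have "\<exists>T. \<forall>n. P n (T n) \<and> T (Suc n) \<subseteq> T n"
  proof (rule dependent_nat_choice)
    show "\<exists>x. P 0 x" using step[of UNIV 0] a by (auto simp: \<mu>_def)
    show "\<exists>y. P (Suc n) y \<and> y \<subseteq> x" if "P n x" for x n
      using step[of x "Suc n"] that by (simp add: P_def)
  qed
  then obtain T where T: "\<And>n. P n (T n)" "\<And>n. T (Suc n) \<subseteq> T n" by blast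
  have dec: "decseq T" using T(2) by (simp add: decseq_Suc_iff)
  have closed: "closed (T k)" and cover: "\<exists>N. finite N \<and> T k \<subseteq> (\<Union>x\<in>N. cball x (1 / 2 ^ k))"
    and less: "a < \<mu> (T k)" for k
    using T(1)[of k] by (simp_all add: P_def)
  let ?C = "\<Inter>k. T k"
  let ?A = "\<lambda>k. closure (fst ` (F \<inter> UNIV \<times> T k))"
  note inter = proj_INT_small_covers[OF F closed dec cover]
  have sets_A: "?A k \<in> sets Q" for k by (simp add: Q(2))
  \<comment> \<open>Outer measure need not be continuous along decreasing sequences. The closures
    are measurable, so continuity from above holds for them because \<open>Q\<close> is finite, and
    their intersection lies in the projection over the compact set \<open>?C\<close>.\<close>
  have "a \<le> (INF k. emeasure Q (?A k))"
  proof (rule INF_greatest)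
    fix k
    have "\<mu> (T k) \<le> outer_measure_of Q (?A k)"
      unfolding \<mu>_def by (intro outer_measure_of_mono closure_subset)
    with less[of k] sets_A[of k] show "a \<le> emeasure Q (?A k)" by simp
  qed
  also have "\<dots> = emeasure Q (\<Inter>k. ?A k)"
  proof (rule INF_emeasure_decseq)
    show "decseq ?A"
      unfolding decseq_def using dec
      by (intro allI impI closure_mono image_mono Int_mono Sigma_mono) (auto simp: decseq_def)
  qed (use sets_A in auto)
  also have "\<dots> \<le> emeasure Q (fst ` (F \<inter> UNIV \<times> ?C))"
    using closed_proj_compact[OF F inter(1)] by (intro emeasure_mono inter(2)) (simp add: Q(2))
  finally show ?thesis using inter(1) by blast
qed

text \<open>At each stage the least index is chosen for which \<open>x\<close> stays in the
  projection of \<open>F\<close> over the current cell. Cells are compact, so these projections are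
  closed and every choice is Borel; the chosen centres converge to a point of the fibre over
  \<open>x\<close>.\<close>

lemma compact_selection:
  fixes F :: "('a::metric_space \<times> 'b::{metric_space, second_countable_topology}) set"
  assumes F: "closed F" and C: "compact C"
  shows "\<exists>h\<in>borel_measurable borel. \<forall>x\<in>fst ` (F \<inter> UNIV \<times> C). (x, h x) \<in> F"
proof -
  obtain d :: "nat \<Rightarrow> 'b" where d: "\<And>w e. e > 0 \<Longrightarrow> \<exists>i. dist (d i) w \<le> e"
    using countable_dense_sequence by blast
  \<comment> \<open>Index lists are kept newest first: the length of the tail gives the current
    radius, and \<open>hd\<close> recovers the latest centre.\<close>
  define cell where "cell = rec_list C (\<lambda>i l R. R \<inter> cball (d i) (1 / 2 ^ length l))"
  have cell_simps [simp]: "cell [] = C" "cell (i # l) = cell l \<inter> cball (d i) (1 / 2 ^ length l)" for i l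
    by (simp_all add: cell_def)
  define V where "V l = fst ` (F \<inter> UNIV \<times> cell l)" for l
  have "compact (cell l)" for l
    by (induction l) (simp_all add: C compact_Int_closed)
  then have V_closed: "closed (V l)" for l
    unfolding V_def by (intro closed_proj_compact F)
  have V_iff: "x \<in> V l \<longleftrightarrow> (\<exists>w\<in>cell l. (x, w) \<in> F)" for x l
    unfolding V_def by force
  define pre where "pre k x = rec_nat [] (\<lambda>k l. (LEAST i. x \<in> V (i # l)) # l) k" for k x
  have pre_simps [simp]: "pre 0 x = []" "pre (Suc k) x = (LEAST i. x \<in> V (i # pre k x)) # pre k x" for k x
    by (simp_all add: pre_def)
  have length_pre [simp]: "length (pre k x) = k" for k x by (induction k) auto
  have pre_meas: "pre k \<in> measurable borel (count_space UNIV)" for k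
  proof (induction k)
    case (Suc k)
    have "(\<lambda>x. x \<in> V (i # pre k x)) \<in> measurable borel (count_space UNIV)" for i
      by (rule measurable_compose_countable[OF _ Suc]) (simp add: pred_def V_closed)
    then have "(\<lambda>x. LEAST i. x \<in> V (i # pre k x)) \<in> measurable borel (count_space UNIV)"
      by (rule measurable_Least)
    then have "(\<lambda>x. (LEAST i. x \<in> V (i # pre k x)) # l) \<in> measurable borel (count_space UNIV)" for l
      by (rule measurable_compose) simp
    from measurable_compose_countable[OF this Suc]
    have "(\<lambda>x. (LEAST i. x \<in> V (i # pre k x)) # pre k x) \<in> measurable borel (count_space UNIV)" .
    then show ?case by simp
  qed simp
  have V_pre: "x \<in> V (pre k x)" if "x \<in> V []" for x k
  proof (induction k)
    case (Suc k)
    then obtain w where w: "w \<in> cell (pre k x)" "(x, w) \<in> F" by (auto simp: V_iff)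
    obtain i where "dist (d i) w \<le> 1 / 2 ^ k" using d[of "1 / 2 ^ k"] by auto
    with w have "x \<in> V (i # pre k x)" by (auto simp: V_iff)
    then show ?case unfolding pre_simps by (rule LeastI)
  qed (use that in simp)
  have cell_mono: "cell (pre n x) \<subseteq> cell (pre m x)" if "m \<le> n" for m n x
    by (rule lift_Suc_antimono_le[of "\<lambda>k. cell (pre k x)", OF _ that]) auto
  define g where "g k x = (if x \<in> V [] then d (hd (pre (Suc k) x)) else d 0)" for k x
  have g_meas: "g k \<in> borel_measurable borel" for k
  proof -
    have "(\<lambda>x. (\<lambda>l. d (hd l)) (pre (Suc k) x)) \<in> borel_measurable borel"
      by (rule measurable_compose[OF pre_meas]) simp
    then show ?thesis unfolding g_def using V_closed[of "[]"]
      by (intro measurable_If_set) (auto simp del: pre_simps)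
  qed
  have "\<exists>l. (\<lambda>k. g k x) \<longlonglongrightarrow> l \<and> (x \<in> V [] \<longrightarrow> (x, l) \<in> F)" for x
  proof (cases "x \<in> V []")
    case False
    then show ?thesis by (auto simp: g_def)
  next
    case True
    have "\<forall>k. \<exists>w. w \<in> cell (pre k x) \<and> (x, w) \<in> F"
      using V_pre[OF True] by (auto simp: V_iff)
    then obtain w where w: "\<And>k. w k \<in> cell (pre k x)" "\<And>k. (x, w k) \<in> F" by metis
    \<comment> \<open>The ball of centre \<open>g k x\<close> and radius \<open>(1/2) ^ k\<close>
      contains the cell of stage \<open>k + 1\<close>, hence every later witness; the centre itself
      need lie neither in \<open>C\<close> nor in the fibre.\<close>
    have dist_gw: "dist (g k x) (w m) \<le> (1/2) ^ k" if "k < m" for k m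
    proof -
      have "w m \<in> cell (pre (Suc k) x)" using w(1)[of m] cell_mono[of "Suc k" m x] that by auto
      with True show ?thesis by (simp add: g_def power_one_over)
    qed
    have "\<forall>k. w k \<in> C" using w(1) cell_mono[of 0 _ x] by auto
    then obtain l r where l: "l \<in> C" "strict_mono (r :: nat \<Rightarrow> nat)" "(w \<circ> r) \<longlonglongrightarrow> l"
      using C unfolding compact_def by metis
    have lim: "(\<lambda>n. (x, w (r n))) \<longlonglongrightarrow> (x, l)"
      using l(3) by (intro tendsto_Pair) (auto simp: o_def)
    have "(x, l) \<in> F" by (rule closed_sequentially[OF F _ lim]) (simp add: w(2))
    \<comment> \<open>Only a subsequence of the witnesses is known to converge, but this bound holds
      for every \<open>k\<close> and forces the whole sequence of centres to converge to
      \<open>l\<close>.\<close>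
    moreover have "dist (g k x) l \<le> (1/2) ^ k" for k
    proof (rule tendsto_upperbound)
      show "(\<lambda>n. dist (g k x) (w (r n))) \<longlonglongrightarrow> dist (g k x) l"
        using l(3) by (intro tendsto_intros) (simp add: o_def)
      show "\<forall>\<^sub>F n in sequentially. dist (g k x) (w (r n)) \<le> (1/2) ^ k"
      proof (rule eventually_sequentiallyI[of "Suc k"])
        fix n assume "Suc k \<le> n"
        then have "k < r n" using seq_suble[OF l(2), of n] by linarith
        then show "dist (g k x) (w (r n)) \<le> (1/2) ^ k" by (rule dist_gw)
      qed
    qed simp
    then have "(\<lambda>k. g k x) \<longlonglongrightarrow> l"
      by (subst tendsto_dist_iff, intro tendsto_sandwich[OF _ _ tendsto_const LIMSEQ_power_zero[of "1/2::real"]])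
         (auto intro: always_eventually)
    ultimately show ?thesis by blast
  qed
  then obtain h where h: "\<And>x. (\<lambda>k. g k x) \<longlonglongrightarrow> h x" "\<And>x. x \<in> V [] \<Longrightarrow> (x, h x) \<in> F" by metis
  have "h \<in> borel_measurable borel"
    by (rule borel_measurable_LIMSEQ_metric[OF g_meas]) (rule h(1))
  with h(2) show ?thesis by (auto simp: V_def)
qed

text \<open>Take a measurable hull \<open>U\<close> of the projection. If it is null it serves as
  \<open>E\<close>. Otherwise there are values strictly below its measure that tend to it, the
  projections over the corresponding compact sets exhaust \<open>U\<close> up to a null set, and the
  selections over them are patched together by the least index.\<close>

lemma closed_uniformization:
  fixes F :: "('a::metric_space \<times> 'b::{complete_space, second_countable_topology}) set"
  assumes Q: "finite_measure Q" "sets Q = sets borel" and F: "closed F"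
  shows "\<exists>h\<in>borel_measurable borel. \<exists>E\<in>null_sets Q. \<forall>x\<in>fst ` F - E. (x, h x) \<in> F"
proof -
  interpret finite_measure Q by fact
  have space: "space Q = UNIV" using sets_eq_imp_space_eq[OF Q(2)] by simp
  obtain U where U: "U \<in> sets Q" "fst ` F \<subseteq> U" "outer_measure_of Q (fst ` F) = emeasure Q U"
    using outer_measure_of_attain[of "fst ` F" Q] by (auto simp: space)
  show ?thesis
  proof (cases "emeasure Q U = 0")
    case True
    with U show ?thesis by (intro bexI[of _ "\<lambda>_. undefined"] bexI[of _ U]) auto
  next
    case False
    then have "0 < emeasure Q U" by (simp add: zero_less_iff_neq_zero)
    then obtain a where a: "\<And>n::nat. a n < emeasure Q U" "a \<longlonglongrightarrow> emeasure Q U"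
      using approx_from_below_dense_linorder by metis
    then have "\<forall>n. \<exists>C. compact C \<and> a n \<le> emeasure Q (fst ` (F \<inter> UNIV \<times> C))"
      using projection_inner_compact[OF Q F] U(3) by auto
    then obtain C where C: "\<And>n. compact (C n)" "\<And>n. a n \<le> emeasure Q (fst ` (F \<inter> UNIV \<times> C n))"
      by metis
    define A where "A n = fst ` (F \<inter> UNIV \<times> C n)" for n
    have A_sets: "A n \<in> sets borel" for n
      using closed_proj_compact[OF F C(1)] by (simp add: A_def)
    have A_sub: "(\<Union>n. A n) \<subseteq> U" using U(2) by (auto simp: A_def)
    have UA: "(\<Union>n. A n) \<in> sets Q" using A_sets Q(2) by auto
    have "\<forall>n. \<exists>h\<in>borel_measurable borel. \<forall>x\<in>A n. (x, h x) \<in> F"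
      unfolding A_def using compact_selection[OF F C(1)] by blast
    then obtain h where h: "\<And>n. h n \<in> borel_measurable borel" "\<And>n x. x \<in> A n \<Longrightarrow> (x, h n x) \<in> F"
      by metis
    define H where "H x = h (LEAST n. x \<in> A n) x" for x
    have "(\<lambda>x. LEAST n. x \<in> A n) \<in> measurable borel (count_space UNIV)"
      using A_sets by (intro measurable_Least) (simp add: pred_def)
    then have "H \<in> borel_measurable borel"
      unfolding H_def by (rule measurable_compose_countable[OF h(1)])
    moreover have "emeasure Q U \<le> emeasure Q (\<Union>n. A n)"
    proof (rule LIMSEQ_le_const2[OF a(2)])
      have "a n \<le> emeasure Q (\<Union>n. A n)" for n
        using C(2)[of n] emeasure_mono[OF UN_upper[of n UNIV A] UA] by (simp add: A_def)
      then show "\<exists>N. \<forall>n\<ge>N. a n \<le> emeasure Q (\<Union>n. A n)" by blast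
    qed
    then have "emeasure Q (U - (\<Union>n. A n)) = 0"
      using emeasure_Diff[OF _ U(1) UA A_sub] by (simp add: diff_eq_0_ennreal less_top[symmetric])
    then have "U - (\<Union>n. A n) \<in> null_sets Q" using U(1) UA by auto
    moreover have "(x, H x) \<in> F" if "x \<in> fst ` F - (U - (\<Union>n. A n))" for x
    proof -
      obtain n where "x \<in> A n" using \<open>x \<in> _\<close> U(2) by blast
      then have "x \<in> A (LEAST n. x \<in> A n)" by (rule LeastI)
      then show ?thesis unfolding H_def by (rule h(2))
    qed
    ultimately show ?thesis by blast
  qed
qed

text \<open>The auxiliary sequence is regrouped with \<open>y\<close>, so that a closed subset of X
  \<times> (Y \<times> N^N) is uniformized over X; the sequence component of the selected pair is
  then dropped.\<close>

lemma borel_uniformization: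
  fixes B :: "('a::polish_space \<times> 'b::{complete_space, second_countable_topology}) set"
  assumes Q: "finite_measure Q" "sets Q = sets borel" and B: "B \<in> sets borel"
  shows "\<exists>h\<in>borel_measurable borel. \<exists>E\<in>null_sets Q. \<forall>x\<in>fst ` B - E. (x, h x) \<in> B"
proof -
  obtain F :: "(('a \<times> 'b) \<times> (nat \<Rightarrow> nat discrete)) set" where F: "closed F" "B = fst ` F"
    using suslin_borel[OF B] unfolding suslin_def by blast
  let ?G = "(\<lambda>p. ((fst p, fst (snd p)), snd (snd p))) -` F"
  have "closed ?G" by (rule closed_vimage[OF F(1)]) (intro continuous_intros)
  from closed_uniformization[OF Q this] obtain h E
    where h: "h \<in> borel_measurable borel" "E \<in> null_sets Q" "\<And>x. x \<in> fst ` ?G - E \<Longrightarrow> (x, h x) \<in> ?G"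
    by blast
  have "(x, fst (h x)) \<in> B" if "x \<in> fst ` B - E" for x
  proof -
    obtain y s where "((x, y), s) \<in> F" using \<open>x \<in> _\<close> by (auto simp: F(2))
    then have "(x, (y, s)) \<in> ?G" by simp
    from imageI[OF this, of fst] have "(x, h x) \<in> ?G" using h(3)[of x] \<open>x \<in> _\<close> by simp
    then have "((x, fst (h x)), snd (h x)) \<in> F" by simp
    from imageI[OF this, of fst] show ?thesis by (simp add: F(2))
  qed
  moreover have "(\<lambda>x. fst (h x)) \<in> borel_measurable borel"
    by (rule measurable_compose[OF h(1)]) (intro borel_measurable_continuous_onI continuous_intros)
  ultimately show ?thesis using h(2) by (intro bexI[of _ "\<lambda>x. fst (h x)"] bexI[of _ E]) simp_all
qed

section \<open>Expectations of extended real functions\<close>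

lemma measurable_completion_AE:
  assumes f: "f \<in> measurable M N" and g: "g \<in> space M \<rightarrow> space N" and eq: "AE x in M. g x = f x"
  shows "g \<in> measurable (completion M) N"
proof (rule measurableI)
  fix A assume A: "A \<in> sets N"
  obtain E where E: "{x \<in> space M. g x \<noteq> f x} \<subseteq> E" "E \<in> null_sets M"
    using eq by (rule AE_E) auto
  have split: "g -` A \<inter> space M = (f -` A \<inter> space M - E) \<union> (g -` A \<inter> space M \<inter> E)"
    using E(1) by auto
  moreover have "f -` A \<inter> space M - E \<in> sets (completion M)"
    using measurable_sets[OF f A] E(2) by (intro sets_completionI_sets) auto
  moreover have "g -` A \<inter> space M \<inter> E \<in> sets (completion M)"
    using E(2) by (intro null_sets_completion[of E]) auto
  ultimately show "g -` A \<inter> space (completion M) \<in> sets (completion M)" by (subst space_completion, subst split) (rule sets.Un)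
qed (use g in auto)

text \<open>\<open>nn_integral\<close> is a supremum over simple functions below the integrand,
  defined without measurability and unchanged by completion. Expectations of the transform can thus
  be computed under \<open>Q\<close> itself.\<close>

lemma ereal_expect_completion: "ereal_expect (completion M) f = ereal_expect M f"
  by (simp add: ereal_expect_def nn_integral_completion)

lemma ereal_expect_mono_AE:
  assumes "AE x in M. f x \<le> g x"
  shows "ereal_expect M f \<le> ereal_expect M g"
proof -
  have "(\<integral>\<^sup>+ x. e2ennreal (f x) \<partial>M) \<le> (\<integral>\<^sup>+ x. e2ennreal (g x) \<partial>M)"
    by (rule nn_integral_mono_AE) (use assms in \<open>auto elim!: eventually_mono intro: e2ennreal_mono\<close>)
  moreover have "(\<integral>\<^sup>+ x. e2ennreal (- g x) \<partial>M) \<le> (\<integral>\<^sup>+ x. e2ennreal (- f x) \<partial>M)"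
    by (rule nn_integral_mono_AE) (use assms in \<open>auto elim!: eventually_mono intro: e2ennreal_mono\<close>)
  ultimately show ?thesis
    unfolding ereal_expect_def by (intro ereal_minus_mono) (simp_all flip: less_eq_ennreal.rep_eq)
qed

lemma ereal_expect_cong_AE:
  assumes "AE x in M. f x = g x"
  shows "ereal_expect M f = ereal_expect M g"
  by (intro antisym ereal_expect_mono_AE) (use assms in \<open>auto elim!: eventually_mono\<close>)

lemma ereal_expect_distr:
  assumes "h \<in> measurable M N" "f \<in> borel_measurable N"
  shows "ereal_expect (distr M N h) f = ereal_expect M (\<lambda>x. f (h x))"
  using assms by (simp add: ereal_expect_def nn_integral_distr)

text \<open>The pointwise identity \<open>pw\<close> has no subtraction left between its terms, so
  it can be integrated in \<open>ennreal\<close>. The bounds \<open>?p \<le> ?a\<close> and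
  \<open>?q \<le> ?b + ?c\<close> make \<open>?p\<close> or \<open>?q\<close> finite according to
  which part of \<open>f\<close> is integrable, which excludes \<infinity> - \<infinity> on both
  sides.\<close>

lemma ereal_expect_diff:
  fixes k :: "'a \<Rightarrow> ennreal"
  assumes [measurable]: "f \<in> borel_measurable M" "k \<in> borel_measurable M"
    and k: "(\<integral>\<^sup>+ x. k x \<partial>M) < \<infinity>"
    and f: "(\<integral>\<^sup>+ x. e2ennreal (f x) \<partial>M) < \<infinity> \<or> (\<integral>\<^sup>+ x. e2ennreal (- f x) \<partial>M) < \<infinity>"
  shows "ereal_expect M (\<lambda>x. f x - enn2ereal (k x)) = ereal_expect M f - enn2ereal (\<integral>\<^sup>+ x. k x \<partial>M)"
proof -
  have pw: "e2ennreal (a - enn2ereal b) + (e2ennreal (- a) + b) = e2ennreal (- (a - enn2ereal b)) + e2ennreal a"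
    "e2ennreal (a - enn2ereal b) \<le> e2ennreal a" "e2ennreal (- (a - enn2ereal b)) \<le> e2ennreal (- a) + b"
    if "b \<noteq> \<infinity>" for a b
    using that
    by (cases a; cases b rule: ennreal_cases; auto simp: ennreal_plus_if ennreal_neg e2ennreal_neg
          intro: ennreal_leI)+
  let ?p = "\<integral>\<^sup>+ x. e2ennreal (f x - enn2ereal (k x)) \<partial>M" and ?q = "\<integral>\<^sup>+ x. e2ennreal (- (f x - enn2ereal (k x))) \<partial>M"
  let ?a = "\<integral>\<^sup>+ x. e2ennreal (f x) \<partial>M" and ?b = "\<integral>\<^sup>+ x. e2ennreal (- f x) \<partial>M"
  let ?c = "\<integral>\<^sup>+ x. k x \<partial>M"
  have fin: "AE x in M. k x \<noteq> \<infinity>" using k by (intro nn_integral_noteq_infinite) auto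
  have "?p + (?b + ?c) = (\<integral>\<^sup>+ x. e2ennreal (f x - enn2ereal (k x)) + (e2ennreal (- f x) + k x) \<partial>M)"
    by (simp add: nn_integral_add)
  also have "\<dots> = (\<integral>\<^sup>+ x. e2ennreal (- (f x - enn2ereal (k x))) + e2ennreal (f x) \<partial>M)"
    by (rule nn_integral_cong_AE) (use fin pw(1) in \<open>auto elim!: eventually_mono\<close>)
  also have "\<dots> = ?q + ?a" by (simp add: nn_integral_add)
  finally have eq: "?p + (?b + ?c) = ?q + ?a" .
  have "?p \<le> ?a"
    by (rule nn_integral_mono_AE) (use fin pw(2) in \<open>auto elim!: eventually_mono\<close>)
  moreover have "?q \<le> (\<integral>\<^sup>+ x. e2ennreal (- f x) + k x \<partial>M)"
    by (rule nn_integral_mono_AE) (use fin pw(3) in \<open>auto elim!: eventually_mono\<close>)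
  then have "?q \<le> ?b + ?c" by (simp add: nn_integral_add)
  ultimately have "enn2ereal ?p - enn2ereal ?q = enn2ereal ?a - enn2ereal ?b - enn2ereal ?c"
    using eq k f
    by (cases ?p rule: ennreal_cases; cases ?q rule: ennreal_cases; cases ?a rule: ennreal_cases;
        cases ?b rule: ennreal_cases; cases ?c rule: ennreal_cases; simp add: top_unique flip: ennreal_plus)
  then show ?thesis by (simp add: ereal_expect_def)
qed

text \<open>Shifting by \<open>m\<close> leaves a single nonnegative integral, the form in which
  monotone convergence applies.\<close>

lemma (in prob_space) ereal_expect_bounded_below:
  fixes f :: "'a \<Rightarrow> ereal" and m :: real
  assumes [measurable]: "f \<in> borel_measurable M" and f: "\<And>x. x \<in> space M \<Longrightarrow> - ereal m \<le> f x" and m: "0 \<le> m"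
  shows "ereal_expect M f = enn2ereal (\<integral>\<^sup>+ x. e2ennreal (f x + ereal m) \<partial>M) - ereal m"
proof -
  have nonneg: "0 \<le> f x + ereal m" if "x \<in> space M" for x using f[OF that] by (cases "f x") auto
  then have 0: "(\<integral>\<^sup>+ x. e2ennreal (- (f x + ereal m)) \<partial>M) = 0"
    by (simp add: e2ennreal_neg cong: nn_integral_cong)
  have "ereal_expect M f = ereal_expect M (\<lambda>x. (f x + ereal m) - enn2ereal (ennreal m))"
  proof (intro ereal_expect_cong_AE AE_I2)
    show "f x = f x + ereal m - enn2ereal (ennreal m)" for x using m by (cases "f x") auto
  qed
  also have "\<dots> = ereal_expect M (\<lambda>x. f x + ereal m) - enn2ereal (\<integral>\<^sup>+ x. ennreal m \<partial>M)"
    by (rule ereal_expect_diff) (use 0 in \<open>auto simp: emeasure_space_1\<close>)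
  also have "ereal_expect M (\<lambda>x. f x + ereal m) = enn2ereal (\<integral>\<^sup>+ x. e2ennreal (f x + ereal m) \<partial>M)"
    by (simp add: ereal_expect_def 0 zero_ennreal.rep_eq)
  finally show ?thesis using m by (simp add: emeasure_space_1)
qed

lemma (in prob_space) one_sided_bound_integrals:
  fixes f :: "'a \<Rightarrow> ereal"
  assumes "(\<exists>m::real. \<forall>x. ereal m \<le> f x) \<or> (\<exists>m::real. \<forall>x. f x \<le> ereal m)"
  shows "(\<integral>\<^sup>+ x. e2ennreal (f x) \<partial>M) < \<infinity> \<or> (\<integral>\<^sup>+ x. e2ennreal (- f x) \<partial>M) < \<infinity>"
  using assms
proof (elim disjE exE)
  fix m :: real assume m: "\<forall>x. ereal m \<le> f x"
  have "(\<integral>\<^sup>+ x. e2ennreal (- f x) \<partial>M) \<le> (\<integral>\<^sup>+ x. ennreal (- m) \<partial>M)"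
  proof (rule nn_integral_mono)
    fix x
    have "ereal m \<le> f x" using m by blast
    then have "- f x \<le> - ereal m" by (simp only: ereal_minus_le_minus)
    from e2ennreal_mono[OF this] show "e2ennreal (- f x) \<le> ennreal (- m)" by simp
  qed
  then show ?thesis by (simp add: emeasure_space_1 le_less_trans)
next
  fix m :: real assume m: "\<forall>x. f x \<le> ereal m"
  have "(\<integral>\<^sup>+ x. e2ennreal (f x) \<partial>M) \<le> (\<integral>\<^sup>+ x. ennreal m \<partial>M)"
    using m e2ennreal_mono[of _ "ereal m"] by (intro nn_integral_mono) simp
  then show ?thesis by (simp add: emeasure_space_1 le_less_trans)
qed

section \<open>Near-optimal selections\<close>

text \<open>Wherever a selection misses \<open>B n\<close> it is replaced by the identity. The
  dichotomy in the second conclusion thereby holds at every \<open>x\<close>, while success on the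
  projections holds off one null set common to all \<open>n\<close>.\<close>

lemma borel_uniformization_seq:
  fixes B :: "nat \<Rightarrow> ('a::polish_space \<times> 'a) set"
  assumes Q: "finite_measure Q" "sets Q = sets borel" and B: "\<And>n. B n \<in> sets borel"
  shows "\<exists>h. (\<forall>n. h n \<in> borel_measurable borel) \<and> (\<forall>n x. (x, h n x) \<in> B n \<or> h n x = x)
    \<and> (AE x in Q. \<forall>n. x \<in> fst ` B n \<longrightarrow> (x, h n x) \<in> B n)"
proof -
  have "\<exists>h\<in>borel_measurable borel. \<exists>E\<in>null_sets Q. \<forall>x\<in>fst ` B n - E. (x, h x) \<in> B n" for n
    by (rule borel_uniformization[OF Q B])
  then obtain h0 E where h0 [measurable]: "\<And>n. h0 n \<in> borel_measurable borel" and E: "\<And>n. E n \<in> null_sets Q"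
    and h0_B: "\<And>n x. x \<in> fst ` B n - E n \<Longrightarrow> (x, h0 n x) \<in> B n"
    by metis
  define h where "h n x = (if (x, h0 n x) \<in> B n then h0 n x else x)" for n x
  have "h n \<in> borel_measurable borel" for n
  proof -
    have "(\<lambda>x. (x, h0 n x)) \<in> measurable borel borel"
      unfolding borel_prod[symmetric] by measurable
    from measurable_sets[OF this B[of n]] have "{x. (x, h0 n x) \<in> B n} \<in> sets borel"
      by (simp add: vimage_def)
    then show ?thesis unfolding h_def by (intro measurable_If) auto
  qed
  moreover have "AE x in Q. \<forall>n. x \<in> fst ` B n \<longrightarrow> (x, h n x) \<in> B n"
    unfolding AE_all_countable
  proof
    fix n
    show "AE x in Q. x \<in> fst ` B n \<longrightarrow> (x, h n x) \<in> B n"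
      using AE_not_in[OF E[of n]] by eventually_elim (use h0_B[of _ n] in \<open>auto simp: h_def\<close>)
  qed
  moreover have "(x, h n x) \<in> B n \<or> h n x = x" for n x by (simp add: h_def)
  ultimately show ?thesis by blast
qed

text \<open>The second conclusion, that \<open>L \<circ> h n\<close> is bounded wherever \<open>h n\<close> moves a point, is what later keeps
  transport costs integrable when \<open>L\<close> is unbounded above.\<close>

lemma SUP_selection_AE:
  fixes G :: "'a::polish_space \<Rightarrow> 'a \<Rightarrow> ereal" and L :: "'a \<Rightarrow> ereal"
  assumes Q: "finite_measure Q" "sets Q = sets borel"
    and G: "(\<lambda>p. G (fst p) (snd p)) \<in> borel_measurable borel"
    and L: "L \<in> borel_measurable borel" "\<And>x. L x \<noteq> \<infinity>"
  shows "\<exists>h. (\<forall>n. h n \<in> borel_measurable borel)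
    \<and> (\<forall>n. \<exists>N::real. \<forall>x. L (h n x) \<le> ereal N \<or> h n x = x)
    \<and> (AE x in Q. (SUP y. G x y) = (SUP n::nat. G x (h n x)))"
proof -
  \<comment> \<open>A pair encodes a rational level for \<open>G\<close> and a cap on
    \<open>L\<close>. Since \<open>L\<close> never takes the value \<infinity>, each
    \<open>y\<close> satisfies some cap, so the capped sets together still reach the full
    supremum.\<close>
  define B where "B n = (case from_nat n :: rat \<times> nat of
      (q, N) \<Rightarrow> {p. ereal (of_rat q) < G (fst p) (snd p) \<and> L (snd p) \<le> ereal (real N)})" for n :: nat
  have L_snd: "(\<lambda>p. L (snd p)) \<in> borel_measurable (borel :: ('a \<times> 'a) measure)"
    by (rule measurable_compose[OF _ L(1)]) (intro borel_measurable_continuous_onI continuous_intros)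
  have "B n \<in> sets borel" for n
  proof -
    obtain q N where n: "from_nat n = (q :: rat, N :: nat)" by (cases "from_nat n :: rat \<times> nat")
    have "{p. ereal (of_rat q) < G (fst p) (snd p) \<and> L (snd p) \<le> ereal (real N)}
        = {p \<in> space borel. ereal (of_rat q) < G (fst p) (snd p)} \<inter> {p \<in> space borel. L (snd p) \<le> ereal (real N)}"
      by auto
    also have "\<dots> \<in> sets borel"
      using borel_measurable_less[OF borel_measurable_const G] borel_measurable_le[OF L_snd borel_measurable_const]
      by (intro sets.Int) auto
    finally show ?thesis by (simp add: B_def n)
  qed
  from borel_uniformization_seq[OF Q, of B] this obtain h
    where h: "\<And>n. h n \<in> borel_measurable borel" "\<And>n x. (x, h n x) \<in> B n \<or> h n x = x"
      and AE: "AE x in Q. \<forall>n. x \<in> fst ` B n \<longrightarrow> (x, h n x) \<in> B n"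
    by blast
  have "\<exists>N::real. \<forall>x. L (h n x) \<le> ereal N \<or> h n x = x" for n
  proof -
    obtain q N where n: "from_nat n = (q :: rat, N :: nat)" by (cases "from_nat n :: rat \<times> nat")
    then show ?thesis using h(2)[where n = n] by (intro exI[of _ "real N"]) (auto simp: B_def)
  qed
  moreover have "AE x in Q. (SUP y. G x y) = (SUP n::nat. G x (h n x))"
    using AE
  proof eventually_elim
    case (elim x)
    show ?case
    proof (intro antisym SUP_least SUP_upper UNIV_I)
      fix y
      show "G x y \<le> (SUP n. G x (h n x))"
      proof (rule dense_le)
        fix r assume "r < G x y"
        then obtain q :: rat where q: "r < ereal (of_rat q)" "ereal (of_rat q) < G x y"
          using ereal_dense3 by blast
        obtain N where N: "L y \<le> ereal (real N)"
          using L(2)[of y] real_arch_simple by (cases "L y") auto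
        let ?n = "to_nat (q, N)"
        have "(x, y) \<in> B ?n" using q(2) N by (simp add: B_def)
        then have "(x, h ?n x) \<in> B ?n" using elim by (metis fst_conv imageI)
        then have "ereal (of_rat q) < G x (h ?n x)" by (simp add: B_def)
        also have "\<dots> \<le> (SUP n. G x (h n x))" by (rule SUP_upper) simp
        finally show "r \<le> (SUP n. G x (h n x))" using q(1) by simp
      qed
    qed
  qed
  ultimately show ?thesis using h(1) by blast
qed

text \<open>With \<open>k = lam * c\<close> this is \<open>lam * L_c\<close>: absorbing the
  multiplier into the cost removes it from the intermediate results. An \<open>ennreal\<close> cost
  can be integrated directly by \<open>nn_integral\<close>.\<close>

definition cost_transform :: "('a \<Rightarrow> ereal) \<Rightarrow> ('a \<Rightarrow> 'a \<Rightarrow> ennreal) \<Rightarrow> 'a \<Rightarrow> ereal" where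
  "cost_transform L k x = (SUP y. L y - enn2ereal (k x y))"

lemma cost_transform_selection_AE:
  fixes L :: "'a::polish_space \<Rightarrow> ereal" and k :: "'a \<Rightarrow> 'a \<Rightarrow> ennreal"
  assumes Q: "finite_measure Q" "sets Q = sets borel"
    and L: "L \<in> borel_measurable borel" "\<And>x. L x \<noteq> \<infinity>"
    and k: "(\<lambda>p. k (fst p) (snd p)) \<in> borel_measurable borel"
  shows "\<exists>h. (\<forall>n. h n \<in> borel_measurable borel)
    \<and> (\<forall>n. \<exists>N::real. \<forall>x. L (h n x) \<le> ereal N \<or> h n x = x)
    \<and> (AE x in Q. cost_transform L k x = (SUP n::nat. L (h n x) - enn2ereal (k x (h n x))))"
proof -
  have "(\<lambda>p. L (snd p)) \<in> borel_measurable (borel :: ('a \<times> 'a) measure)"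
    by (rule measurable_compose[OF _ L(1)]) (intro borel_measurable_continuous_onI continuous_intros)
  then have "(\<lambda>p. L (snd p) - enn2ereal (k (fst p) (snd p))) \<in> borel_measurable borel"
    using k by measurable
  from SUP_selection_AE[OF Q this L] show ?thesis
    unfolding cost_transform_def[symmetric] .
qed

section \<open>Universal measurability of the transform and the upper bound by couplings\<close>

lemma measurable_pair_graph:
  fixes f :: "'a::second_countable_topology \<Rightarrow> 'a"
  assumes [measurable]: "f \<in> borel_measurable borel"
  shows "(\<lambda>x. (x, f x)) \<in> measurable borel (borel :: ('a \<times> 'a) measure)"
  unfolding borel_prod[symmetric] by measurable

text \<open>For each \<open>Q\<close> the transform agrees \<open>Q\<close>-almost everywhere with a
  countable supremum of Borel functions. These functions and the exceptional set change with
  \<open>Q\<close>, so the result is measurability for each completion.\<close>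

lemma cost_transform_universally_measurable:
  fixes L :: "'a::polish_space \<Rightarrow> ereal" and k :: "'a \<Rightarrow> 'a \<Rightarrow> ennreal"
  assumes L: "L \<in> borel_measurable borel" "\<And>x. L x \<noteq> \<infinity>"
    and k: "(\<lambda>p. k (fst p) (snd p)) \<in> borel_measurable borel"
  shows "universally_measurable (cost_transform L k)"
  unfolding universally_measurable_def
proof
  fix Q :: "'a measure" assume "Q \<in> prob_measures"
  then have Q: "finite_measure Q" "sets Q = sets borel"
    by (auto simp: prob_measures_def prob_space.finite_measure)
  obtain h where h: "\<And>n. h n \<in> borel_measurable borel"
    "AE x in Q. cost_transform L k x = (SUP n::nat. L (h n x) - enn2ereal (k x (h n x)))"
    using cost_transform_selection_AE[OF Q L k] by blast
  have "(\<lambda>x. SUP n::nat. L (h n x) - enn2ereal (k x (h n x))) \<in> borel_measurable borel"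
    using measurable_compose[OF h(1) L(1)] measurable_compose[OF measurable_pair_graph[OF h(1)] k] by simp
  then have "(\<lambda>x. SUP n::nat. L (h n x) - enn2ereal (k x (h n x))) \<in> borel_measurable Q"
    by (simp add: measurable_cong_sets[OF Q(2) refl])
  from measurable_completion_AE[OF this _ h(2)]
  show "cost_transform L k \<in> borel_measurable (completion Q)" by simp
qed

lemma cost_transform_upper_bound:
  fixes L :: "'a::polish_space \<Rightarrow> ereal" and k :: "'a \<Rightarrow> 'a \<Rightarrow> ennreal"
  assumes L: "L \<in> borel_measurable borel" "\<And>x. L x \<noteq> \<infinity>"
    and bdd: "(\<exists>m::real. \<forall>x. ereal m \<le> L x) \<or> (\<exists>m::real. \<forall>x. L x \<le> ereal m)"
    and k: "(\<lambda>p. k (fst p) (snd p)) \<in> borel_measurable borel"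
    and \<pi>: "\<pi> \<in> couplings \<eta> Q" and \<eta>: "\<eta> \<in> prob_measures"
    and fin: "(\<integral>\<^sup>+ p. k (fst p) (snd p) \<partial>\<pi>) < \<infinity>"
  shows "ereal_expect Q L - enn2ereal (\<integral>\<^sup>+ p. k (fst p) (snd p) \<partial>\<pi>) \<le> ereal_expect \<eta> (cost_transform L k)"
proof -
  have \<pi>_sets [measurable_cong]: "sets \<pi> = sets borel" and \<pi>_prob: "prob_space \<pi>"
    and marg: "distr \<pi> borel fst = \<eta>" "distr \<pi> borel snd = Q"
    using \<pi> by (auto simp: couplings_def prob_measures_def)
  interpret \<pi>: prob_space \<pi> by fact
  have \<eta>': "finite_measure \<eta>" "sets \<eta> = sets borel"
    using \<eta> by (auto simp: prob_measures_def prob_space.finite_measure)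
  have fst_snd: "fst \<in> measurable \<pi> (borel :: 'a measure)" "snd \<in> measurable \<pi> (borel :: 'a measure)"
    unfolding measurable_cong_sets[OF \<pi>_sets refl]
    by (intro borel_measurable_continuous_onI continuous_intros)+
  note [measurable] = measurable_compose[OF fst_snd(2) L(1)]
  have k\<pi> [measurable]: "(\<lambda>p. k (fst p) (snd p)) \<in> borel_measurable \<pi>"
    using k by (simp add: measurable_cong_sets[OF \<pi>_sets refl])
  obtain h where h: "\<And>n. h n \<in> borel_measurable borel"
    "AE x in \<eta>. cost_transform L k x = (SUP n::nat. L (h n x) - enn2ereal (k x (h n x)))"
    using cost_transform_selection_AE[OF \<eta>' L k] by blast
  \<comment> \<open>Passing to the marginal requires a Borel integrand. \<open>?S\<close> is a Borel
    version of the transform off an \<eta>-null set, which pulls back under \<open>fst\<close> to a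
    \<pi>-null set.\<close>
  let ?S = "\<lambda>x. SUP n::nat. L (h n x) - enn2ereal (k x (h n x))"
  have S: "?S \<in> borel_measurable borel"
    using measurable_compose[OF h(1) L(1)] measurable_compose[OF measurable_pair_graph[OF h(1)] k] by simp
  have AE: "AE p in \<pi>. cost_transform L k (fst p) = ?S (fst p)"
    by (rule AE_distrD[OF fst_snd(1)]) (unfold marg(1), rule h(2))
  have "ereal_expect Q L = ereal_expect \<pi> (\<lambda>p. L (snd p))"
    unfolding marg(2)[symmetric] by (rule ereal_expect_distr[OF fst_snd(2) L(1)])
  also have "\<dots> - enn2ereal (\<integral>\<^sup>+ p. k (fst p) (snd p) \<partial>\<pi>)
      = ereal_expect \<pi> (\<lambda>p. L (snd p) - enn2ereal (k (fst p) (snd p)))"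
    by (rule ereal_expect_diff[symmetric])
       (use fin \<pi>.one_sided_bound_integrals[of "\<lambda>p. L (snd p)"] bdd in auto)
  also have "\<dots> \<le> ereal_expect \<pi> (\<lambda>p. cost_transform L k (fst p))"
    unfolding cost_transform_def by (intro ereal_expect_mono_AE AE_I2 SUP_upper UNIV_I)
  also have "\<dots> = ereal_expect \<pi> (\<lambda>p. ?S (fst p))"
    by (rule ereal_expect_cong_AE[OF AE])
  also have "\<dots> = ereal_expect \<eta> ?S"
    unfolding marg(1)[symmetric] by (rule ereal_expect_distr[OF fst_snd(1) S, symmetric])
  also have "\<dots> = ereal_expect \<eta> (cost_transform L k)"
    by (rule ereal_expect_cong_AE) (use h(2) in \<open>auto elim!: eventually_mono\<close>)
  finally show ?thesis .
qed

text \<open>Monotone convergence makes one finite stage \<open>n\<close> sufficient, even when the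
  transform has infinite expectation. At a finite stage, \<open>L\<close> is capped at every point
  that is moved, which bounds the cost uniformly.\<close>

lemma near_optimal_selection_below:
  fixes L :: "'a::polish_space \<Rightarrow> ereal" and k :: "'a \<Rightarrow> 'a \<Rightarrow> ennreal" and m r :: real
  assumes Q: "prob_space Q" "sets Q = sets borel"
    and L: "L \<in> borel_measurable borel" "\<And>x. L x \<noteq> \<infinity>" and bdd: "\<And>x. ereal m \<le> L x"
    and k: "(\<lambda>p. k (fst p) (snd p)) \<in> borel_measurable borel" and k_diag: "\<And>x. k x x = 0"
    and r: "ereal r < ereal_expect Q (cost_transform L k)"
  shows "\<exists>f\<in>borel_measurable borel. (\<integral>\<^sup>+ x. k x (f x) \<partial>Q) < \<infinity>
    \<and> ereal r < ereal_expect Q (\<lambda>x. L (f x)) - enn2ereal (\<integral>\<^sup>+ x. k x (f x) \<partial>Q)"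
proof -
  interpret prob_space Q by fact
  obtain h where h: "\<And>n. h n \<in> borel_measurable borel"
    and hN: "\<And>n. \<exists>N::real. \<forall>x. L (h n x) \<le> ereal N \<or> h n x = x"
    and h_AE: "AE x in Q. cost_transform L k x = (SUP n::nat. L (h n x) - enn2ereal (k x (h n x)))"
    using cost_transform_selection_AE[OF finite_measure_axioms Q(2) L k] by blast
  define G where "G x y = L y - enn2ereal (k x y)" for x y
  have G_diag: "G x x = L x" for x by (simp add: G_def k_diag zero_ennreal.rep_eq)
  have L_meas: "(\<lambda>x. L (f x)) \<in> borel_measurable borel" if "f \<in> borel_measurable borel" for f
    using measurable_compose[OF that L(1)] .
  have k_meas: "(\<lambda>x. k x (f x)) \<in> borel_measurable borel" if "f \<in> borel_measurable borel" for f
    using measurable_compose[OF measurable_pair_graph[OF that] k] by simp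
  have G_meas: "(\<lambda>x. G x (f x)) \<in> borel_measurable borel" if "f \<in> borel_measurable borel" for f
    unfolding G_def using L_meas[OF that] k_meas[OF that] by simp
  have Q_meas: "borel_measurable Q = borel_measurable borel"
    by (rule measurable_cong_sets[OF Q(2) refl])
  \<comment> \<open>\<open>f n\<close> is a running argmax, so that \<open>G x (f n x)\<close> increases to the transform; it starts at the identity
    to be bounded below by \<open>m\<close>.\<close>
  define f where "f = rec_nat (\<lambda>x. x) (\<lambda>n g x. if G x (g x) < G x (h n x) then h n x else g x)"
  have f_simps [simp]: "f 0 x = x" "f (Suc n) x = (if G x (f n x) < G x (h n x) then h n x else f n x)" for n x
    by (simp_all add: f_def)
  have f_meas: "f n \<in> borel_measurable borel" for n
  proof (induction n)
    case 0
    have "f 0 = (\<lambda>x. x)" by (simp add: fun_eq_iff)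
    then show ?case by simp
  next
    case (Suc n)
    have "{x \<in> space borel. G x (f n x) < G x (h n x)} \<in> sets borel"
      by (intro borel_measurable_less G_meas h Suc)
    then have "(\<lambda>x. if G x (f n x) < G x (h n x) then h n x else f n x) \<in> borel_measurable borel"
      by (intro measurable_If h Suc)
    moreover have "f (Suc n) = (\<lambda>x. if G x (f n x) < G x (h n x) then h n x else f n x)"
      by (simp add: fun_eq_iff)
    ultimately show ?case by simp
  qed
  have mono: "G x (f n x) \<le> G x (f (Suc n) x)" "G x (h n x) \<le> G x (f (Suc n) x)" for n x
    by (auto simp: not_less)
  have inc: "incseq (\<lambda>n. G x (f n x))" for x by (rule incseq_SucI) (rule mono(1))
  have f_below: "L x \<le> G x (f n x)" for n x
    using incseqD[OF inc, of 0 n x] by (simp add: G_diag)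
  \<comment> \<open>\<open>f (Suc n) x\<close> is either \<open>f n x\<close> or
    \<open>h n x\<close>, so the larger of the two caps works.\<close>
  have f_N: "\<exists>N::real. \<forall>x. L (f n x) \<le> ereal N \<or> f n x = x" for n
  proof (induction n)
    case (Suc n)
    then obtain N1 where N1: "\<And>x. L (f n x) \<le> ereal N1 \<or> f n x = x" by blast
    obtain N2 where N2: "\<And>x. L (h n x) \<le> ereal N2 \<or> h n x = x" using hN by blast
    obtain N where N: "ereal N1 \<le> ereal N" "ereal N2 \<le> ereal N"
      by (metis ereal_less_eq(3) max.cobounded1 max.cobounded2)
    have "L (f (Suc n) x) \<le> ereal N \<or> f (Suc n) x = x" for x
      using N1[of x] N2[of x] by (auto intro: order_trans[OF _ N(1)] order_trans[OF _ N(2)])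
    then show ?case by blast
  qed simp
  have SUP_f: "AE x in Q. cost_transform L k x = (SUP n. G x (f n x))"
    using h_AE
  proof eventually_elim
    case (elim x)
    show ?case
    proof (rule antisym)
      have "(SUP n. G x (h n x)) \<le> (SUP n. G x (f n x))"
        by (rule SUP_mono) (use mono(2) in blast)
      then show "cost_transform L k x \<le> (SUP n. G x (f n x))"
        by (simp only: elim G_def)
      show "(SUP n. G x (f n x)) \<le> cost_transform L k x"
        unfolding cost_transform_def G_def by (intro SUP_least SUP_upper UNIV_I)
    qed
  qed
  have below: "- ereal \<bar>m\<bar> \<le> G x (f n x)" for n x
    using order_trans[OF bdd f_below, of x n] by (rule order_trans[rotated]) simp
  have "ereal_expect Q (cost_transform L k) = ereal_expect Q (\<lambda>x. SUP n. G x (f n x))"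
    by (rule ereal_expect_cong_AE[OF SUP_f])
  also have "\<dots> = enn2ereal (\<integral>\<^sup>+ x. e2ennreal ((SUP n. G x (f n x)) + ereal \<bar>m\<bar>) \<partial>Q) - ereal \<bar>m\<bar>"
  proof (rule ereal_expect_bounded_below)
    show "(\<lambda>x. SUP n. G x (f n x)) \<in> borel_measurable Q"
      unfolding Q_meas using G_meas[OF f_meas] by simp
    show "- ereal \<bar>m\<bar> \<le> (SUP n. G x (f n x))" for x
      using below[of x 0] by (rule order_trans) (rule SUP_upper, simp)
  qed simp
  also have "(\<integral>\<^sup>+ x. e2ennreal ((SUP n. G x (f n x)) + ereal \<bar>m\<bar>) \<partial>Q)
      = (\<integral>\<^sup>+ x. (SUP n. e2ennreal (G x (f n x) + ereal \<bar>m\<bar>)) \<partial>Q)"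
  proof (rule nn_integral_cong)
    fix x
    have "(SUP n. G x (f n x)) + ereal \<bar>m\<bar> = (SUP n. G x (f n x) + ereal \<bar>m\<bar>)"
      by (rule SUP_ereal_add_left[symmetric]) auto
    moreover have "e2ennreal (SUP n. G x (f n x) + ereal \<bar>m\<bar>) = (SUP n. e2ennreal (G x (f n x) + ereal \<bar>m\<bar>))"
      using sup_continuousD[OF sup_continuous_e2ennreal[OF sup_continuous_id], of "\<lambda>n. G x (f n x) + ereal \<bar>m\<bar>"]
        inc[of x] by (simp add: mono_def incseq_def add_right_mono)
    ultimately show "e2ennreal ((SUP n. G x (f n x)) + ereal \<bar>m\<bar>) = (SUP n. e2ennreal (G x (f n x) + ereal \<bar>m\<bar>))"
      by simp
  qed
  also have "\<dots> = (SUP n. \<integral>\<^sup>+ x. e2ennreal (G x (f n x) + ereal \<bar>m\<bar>) \<partial>Q)"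
  proof (rule nn_integral_monotone_convergence_SUP)
    show "incseq (\<lambda>n x. e2ennreal (G x (f n x) + ereal \<bar>m\<bar>))"
      using inc by (auto simp: incseq_def le_fun_def intro!: e2ennreal_mono add_right_mono)
    show "(\<lambda>x. e2ennreal (G x (f n x) + ereal \<bar>m\<bar>)) \<in> borel_measurable Q" for n
      unfolding Q_meas using G_meas[OF f_meas] by simp
  qed
  finally have "ereal (r + \<bar>m\<bar>) < enn2ereal (SUP n. \<integral>\<^sup>+ x. e2ennreal (G x (f n x) + ereal \<bar>m\<bar>) \<partial>Q)"
    using r by (simp add: ereal_less_minus)
  also have "\<dots> = (SUP n. enn2ereal (\<integral>\<^sup>+ x. e2ennreal (G x (f n x) + ereal \<bar>m\<bar>) \<partial>Q))"
  proof (rule sup_continuousD[OF sup_continuous_enn2ereal[OF sup_continuous_id]])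
    show "mono (\<lambda>n. \<integral>\<^sup>+ x. e2ennreal (G x (f n x) + ereal \<bar>m\<bar>) \<partial>Q)"
      using inc by (auto simp: mono_def incseq_def intro!: nn_integral_mono e2ennreal_mono add_right_mono)
  qed
  finally obtain n where "ereal (r + \<bar>m\<bar>) < enn2ereal (\<integral>\<^sup>+ x. e2ennreal (G x (f n x) + ereal \<bar>m\<bar>) \<partial>Q)"
    by (auto simp: less_SUP_iff)
  then have "ereal r < enn2ereal (\<integral>\<^sup>+ x. e2ennreal (G x (f n x) + ereal \<bar>m\<bar>) \<partial>Q) - ereal \<bar>m\<bar>"
    by (simp add: ereal_less_minus)
  also have "\<dots> = ereal_expect Q (\<lambda>x. G x (f n x))"
    by (rule ereal_expect_bounded_below[symmetric]) (use G_meas[OF f_meas] below in \<open>auto simp: Q_meas\<close>)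
  finally have less: "ereal r < ereal_expect Q (\<lambda>x. G x (f n x))" .
  obtain N where N: "\<And>x. L (f n x) \<le> ereal N \<or> f n x = x" using f_N[of n] by blast
  \<comment> \<open>A fixed point costs nothing. At a moved point \<open>L (f n x)\<close> is at
    most \<open>N\<close>, and subtracting the cost leaves at least \<open>m\<close>, so the cost is
    at most \<open>N - m\<close>.\<close>
  have "k x (f n x) \<le> ennreal (N - m)" for x
  proof (cases "f n x = x")
    case True
    then show ?thesis by (simp add: k_diag)
  next
    case False
    then have "L (f n x) \<le> ereal N" using N by blast
    moreover have "ereal m \<le> L (f n x) - enn2ereal (k x (f n x))"
      using order_trans[OF bdd f_below, of x n] by (simp add: G_def)
    ultimately show ?thesis
      by (cases "L (f n x)"; cases "k x (f n x)" rule: ennreal_cases) (auto intro: ennreal_leI)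
  qed
  then have "(\<integral>\<^sup>+ x. k x (f n x) \<partial>Q) \<le> (\<integral>\<^sup>+ x. ennreal (N - m) \<partial>Q)" by (intro nn_integral_mono) auto
  also have "\<dots> < \<infinity>" by (simp add: emeasure_space_1)
  finally have fin: "(\<integral>\<^sup>+ x. k x (f n x) \<partial>Q) < \<infinity>" .
  moreover have "ereal_expect Q (\<lambda>x. L (f n x) - enn2ereal (k x (f n x)))
      = ereal_expect Q (\<lambda>x. L (f n x)) - enn2ereal (\<integral>\<^sup>+ x. k x (f n x) \<partial>Q)"
  proof (rule ereal_expect_diff)
    show "(\<integral>\<^sup>+ x. e2ennreal (L (f n x)) \<partial>Q) < \<infinity> \<or> (\<integral>\<^sup>+ x. e2ennreal (- L (f n x)) \<partial>Q) < \<infinity>"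
      by (rule one_sided_bound_integrals) (use bdd in blast)
  qed (use fin L_meas[OF f_meas] k_meas[OF f_meas] in \<open>auto simp: Q_meas\<close>)
  ultimately show ?thesis using less f_meas unfolding G_def by (intro bexI[of _ "f n"]) auto
qed


text \<open>Here the positive part of the transform is bounded, so an expectation above
  \<open>r\<close> makes its negative part integrable. An \<open>e\<close>-optimal choice then costs
  at most \<open>m + e - S x\<close>, which is dominated by an integrable function.\<close>

lemma near_optimal_selection_above:
  fixes L :: "'a::polish_space \<Rightarrow> ereal" and k :: "'a \<Rightarrow> 'a \<Rightarrow> ennreal" and m r :: real
  assumes Q: "prob_space Q" "sets Q = sets borel"
    and L: "L \<in> borel_measurable borel" and bdd: "\<And>x. L x \<le> ereal m"
    and k: "(\<lambda>p. k (fst p) (snd p)) \<in> borel_measurable borel"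
    and r: "ereal r < ereal_expect Q (cost_transform L k)"
  shows "\<exists>f\<in>borel_measurable borel. (\<integral>\<^sup>+ x. k x (f x) \<partial>Q) < \<infinity>
    \<and> ereal r < ereal_expect Q (\<lambda>x. L (f x)) - enn2ereal (\<integral>\<^sup>+ x. k x (f x) \<partial>Q)"
proof -
  interpret prob_space Q by fact
  have L_fin: "L x \<noteq> \<infinity>" for x using bdd[of x] by auto
  obtain h where h: "\<And>n. h n \<in> borel_measurable borel"
    and h_AE: "AE x in Q. cost_transform L k x = (SUP n::nat. L (h n x) - enn2ereal (k x (h n x)))"
    using cost_transform_selection_AE[OF finite_measure_axioms Q(2) L L_fin k] by blast
  define G where "G x y = L y - enn2ereal (k x y)" for x y
  have L_meas: "(\<lambda>x. L (f x)) \<in> borel_measurable borel" if "f \<in> borel_measurable borel" for f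
    using measurable_compose[OF that L(1)] .
  have k_meas: "(\<lambda>x. k x (f x)) \<in> borel_measurable borel" if "f \<in> borel_measurable borel" for f
    using measurable_compose[OF measurable_pair_graph[OF that] k] by simp
  have G_meas: "(\<lambda>x. G x (f x)) \<in> borel_measurable borel" if "f \<in> borel_measurable borel" for f
    unfolding G_def using L_meas[OF that] k_meas[OF that] by simp
  have Q_meas: "borel_measurable Q = borel_measurable borel"
    by (rule measurable_cong_sets[OF Q(2) refl])
  define S where "S x = (SUP n. G x (h n x))" for x
  have S_meas: "S \<in> borel_measurable borel"
    unfolding S_def using G_meas[OF h] by simp
  have "G x y \<le> ereal m" for x y
    unfolding G_def using ereal_minus_mono[OF bdd enn2ereal_nonneg, of y "k x y"] by simp
  then have S_le: "S x \<le> ereal m" for x unfolding S_def by (intro SUP_least)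
  have "(\<integral>\<^sup>+ x. e2ennreal (S x) \<partial>Q) \<le> (\<integral>\<^sup>+ x. ennreal m \<partial>Q)"
    using S_le e2ennreal_mono[of _ "ereal m"] by (intro nn_integral_mono) simp
  then have S_pos: "(\<integral>\<^sup>+ x. e2ennreal (S x) \<partial>Q) < \<infinity>"
    by (simp add: emeasure_space_1 le_less_trans)
  have "ereal_expect Q (cost_transform L k) = ereal_expect Q S"
    unfolding S_def G_def by (rule ereal_expect_cong_AE[OF h_AE])
  with r have r_S: "ereal r < ereal_expect Q S" by simp
  have S_neg: "(\<integral>\<^sup>+ x. e2ennreal (- S x) \<partial>Q) < \<infinity>"
  proof (rule ccontr)
    assume "\<not> ?thesis"
    then have "ereal_expect Q S = -\<infinity>"
      using S_pos unfolding ereal_expect_def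
      by (cases "\<integral>\<^sup>+ x. e2ennreal (S x) \<partial>Q" rule: ennreal_cases) (auto simp: not_less top_unique)
    with r_S show False by simp
  qed
  obtain e where e: "0 < e" "ereal r < ereal_expect Q S - ereal e"
  proof (cases "ereal_expect Q S")
    case (real s)
    with r_S have "0 < (s - r) / 2" "ereal r < ereal_expect Q S - ereal ((s - r) / 2)"
      by (simp_all add: field_simps)
    then show ?thesis using that by blast
  next
    case PInf
    then show ?thesis using that[of 1] by simp
  qed (use r_S in simp)
  have shift: "ereal_expect Q (\<lambda>x. S x - enn2ereal (ennreal e)) = ereal_expect Q S - enn2ereal (\<integral>\<^sup>+ x. ennreal e \<partial>Q)"
    by (rule ereal_expect_diff) (use S_meas S_pos in \<open>auto simp: Q_meas emeasure_space_1\<close>)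
  \<comment> \<open>The set of indices is empty only where \<open>S x\<close> is -\<infinity>, a
    null set, so the unspecified value of \<open>LEAST\<close> there is harmless; elsewhere
    \<open>S x\<close> is finite and \<open>e > 0\<close>.\<close>
  define idx where "idx x = (LEAST n. S x - ereal e < G x (h n x))" for x
  define f where "f x = h (idx x) x" for x
  have "idx \<in> measurable borel (count_space UNIV)"
    unfolding idx_def
    by (rule measurable_Least) (unfold pred_def, intro borel_measurable_less borel_measurable_ereal_diff S_meas borel_measurable_const G_meas h)
  then have f: "f \<in> borel_measurable borel"
    unfolding f_def by (rule measurable_compose_countable[OF h])
  have "AE x in Q. e2ennreal (- S x) \<noteq> \<infinity>"
    using S_neg S_meas by (intro nn_integral_noteq_infinite) (auto simp: Q_meas)
  then have opt: "AE x in Q. S x \<noteq> -\<infinity> \<and> S x - ereal e < G x (f x)"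
  proof eventually_elim
    case (elim x)
    have fin: "S x \<noteq> -\<infinity>"
    proof
      assume "S x = -\<infinity>"
      with elim show False by simp
    qed
    then have "S x - ereal e < S x" using S_le[of x] e(1) by (cases "S x") auto
    then obtain n where "S x - ereal e < G x (h n x)"
      by (subst (asm) (2) S_def) (auto simp: less_SUP_iff)
    then have "S x - ereal e < G x (f x)" unfolding f_def idx_def by (rule LeastI)
    with fin show ?case by simp
  qed
  have "AE x in Q. k x (f x) \<le> ennreal (\<bar>m\<bar> + e) + e2ennreal (- S x)"
    using opt
  proof eventually_elim
    case (elim x)
    from elim S_le[of x] obtain s where s: "S x = ereal s" by (cases "S x") auto
    from elim s have "ereal (s - e) < L (f x) - enn2ereal (k x (f x))" by (simp add: G_def)
    with bdd[of "f x"] obtain l j where lj: "L (f x) = ereal l" "k x (f x) = ennreal j" "0 \<le> j" "s - e < l - j" "l \<le> m"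
      by (cases "L (f x)"; cases "k x (f x)" rule: ennreal_cases) auto
    then have "j \<le> (\<bar>m\<bar> + e) + max 0 (- s)" by linarith
    then have "ennreal j \<le> ennreal ((\<bar>m\<bar> + e) + max 0 (- s))" by (rule ennreal_leI)
    also have "\<dots> = ennreal (\<bar>m\<bar> + e) + ennreal (- s)"
      using e(1) by (simp add: ennreal_plus ennreal_max_0)
    finally show ?case using lj s by simp
  qed
  then have "(\<integral>\<^sup>+ x. k x (f x) \<partial>Q) \<le> (\<integral>\<^sup>+ x. ennreal (\<bar>m\<bar> + e) + e2ennreal (- S x) \<partial>Q)"
    by (rule nn_integral_mono_AE)
  also have "\<dots> = ennreal (\<bar>m\<bar> + e) + (\<integral>\<^sup>+ x. e2ennreal (- S x) \<partial>Q)"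
    using S_meas by (subst nn_integral_add) (auto simp: Q_meas emeasure_space_1)
  also have "\<dots> < \<infinity>" using S_neg by simp
  finally have fin: "(\<integral>\<^sup>+ x. k x (f x) \<partial>Q) < \<infinity>" .
  have "ereal r < ereal_expect Q (\<lambda>x. S x - enn2ereal (ennreal e))"
    unfolding shift using e by (simp add: emeasure_space_1)
  also have "\<dots> \<le> ereal_expect Q (\<lambda>x. G x (f x))"
  proof (rule ereal_expect_mono_AE)
    show "AE x in Q. S x - enn2ereal (ennreal e) \<le> G x (f x)"
      using opt by eventually_elim (use e(1) in \<open>simp add: less_imp_le\<close>)
  qed
  also have "\<dots> = ereal_expect Q (\<lambda>x. L (f x)) - enn2ereal (\<integral>\<^sup>+ x. k x (f x) \<partial>Q)"
    unfolding G_def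
  proof (rule ereal_expect_diff)
    show "(\<integral>\<^sup>+ x. e2ennreal (L (f x)) \<partial>Q) < \<infinity> \<or> (\<integral>\<^sup>+ x. e2ennreal (- L (f x)) \<partial>Q) < \<infinity>"
      by (rule one_sided_bound_integrals) (use bdd in blast)
  qed (use fin L_meas[OF f] k_meas[OF f] in \<open>auto simp: Q_meas\<close>)
  finally show ?thesis using fin f by blast
qed

section \<open>Return from the scaled cost to \<open>L_c\<close>, and the two inequalities\<close>

theorem theorem6:
  fixes L :: "'a::polish_space \<Rightarrow> ereal"
    and P :: "'a measure"
    and D :: "'a measure \<Rightarrow> 'a measure \<Rightarrow> ennreal"
    and c :: "'a \<Rightarrow> 'a \<Rightarrow> ereal"
    and lam :: real
  assumes L_meas: "L \<in> borel_measurable borel"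
    and L_not_inf: "\<forall>x. L x \<noteq> \<infinity>"
    and L_bdd: "(\<exists>m::real. \<forall>x. ereal m \<le> L x) \<or> (\<exists>M::real. \<forall>x. L x \<le> ereal M)"
    and P_prob: "P \<in> prob_measures"
    and D_pre: "pre_divergence D"
    and D_convex: "convex_on_prob (\<lambda>Q. D Q P)"
    and c_cost: "cost_function c"
    and c_diag: "\<forall>x. c x x = 0"
    and lam_pos: "lam > 0"
  shows "universally_measurable (L_c L c lam)
    \<and> (SUP Q\<in>{Q\<in>prob_measures. OT_reg_div D c Q P < \<infinity>}.
          ereal_expect Q L - ereal lam * enn2ereal (OT_reg_div D c Q P))
      = (SUP Q\<in>{Q\<in>prob_measures. D Q P < \<infinity>}.
          ereal_expect (completion Q) (\<lambda>x. ereal lam * L_c L c lam x) - ereal lam * enn2ereal (D Q P))"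
    (is "_ \<and> ?lhs = ?rhs")
proof -
  define k where "k x y = ennreal lam * e2ennreal (c x y)" for x y
  have c_nonneg: "0 \<le> c x y" for x y using c_cost by (simp add: cost_function_def)
  have "(\<lambda>p. c (fst p) (snd p)) \<in> borel_measurable borel"
  proof (rule borel_measurableI_greater)
    fix t
    have "open {p. t < c (fst p) (snd p)}"
      using c_cost by (simp add: cost_function_def lower_semicont_def case_prod_beta)
    then show "{p \<in> space borel. t < c (fst p) (snd p)} \<in> sets borel" by simp
  qed
  then have c_meas: "(\<lambda>p. e2ennreal (c (fst p) (snd p))) \<in> borel_measurable borel"
    by simp
  then have k_meas: "(\<lambda>p. k (fst p) (snd p)) \<in> borel_measurable borel"
    by (simp add: k_def)
  have k_diag: "k x x = 0" for x using c_diag by (simp add: k_def e2ennreal_neg)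
  have k_ereal: "enn2ereal (k x y) = ereal lam * c x y" for x y
    using lam_pos c_nonneg[of x y]
    by (simp add: k_def times_ennreal.rep_eq enn2ereal_e2ennreal)
  have L_fin: "L x \<noteq> \<infinity>" for x using L_not_inf by simp
  have transform: "cost_transform L k x = ereal lam * L_c L c lam x" for x
  proof -
    \<comment> \<open>\<open>L y\<close> is never \<infinity>, so neither side meets \<infinity> -
      \<infinity>, and distributivity survives infinite costs.\<close>
    have "L y - enn2ereal (k x y) = ereal lam * (L y / ereal lam - c x y)" for y
      unfolding k_ereal using lam_pos L_fin[of y] c_nonneg[of x y]
      by (cases "L y"; cases "c x y") (auto simp: field_simps)
    then show ?thesis
      using lam_pos unfolding cost_transform_def L_c_def by (simp add: Sup_ereal_mult_left' image_comp o_def)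
  qed
  have transform_eq: "cost_transform L k = (\<lambda>x. ereal lam * L_c L c lam x)"
    using transform by (rule ext)
  have "universally_measurable (L_c L c lam)"
    unfolding universally_measurable_def
  proof
    fix \<mu> :: "'a measure" assume "\<mu> \<in> prob_measures"
    then have "cost_transform L k \<in> borel_measurable (completion \<mu>)"
      using cost_transform_universally_measurable[OF L_meas L_fin k_meas] by (simp add: universally_measurable_def)
    then have "(\<lambda>x. ereal (1 / lam) * cost_transform L k x) \<in> borel_measurable (completion \<mu>)" by simp
    moreover have "ereal (1 / lam) * cost_transform L k x = L_c L c lam x" for x
      using lam_pos by (cases "L_c L c lam x") (auto simp: transform)
    ultimately show "L_c L c lam \<in> borel_measurable (completion \<mu>)" by simp
  qed
  moreover have "?lhs \<le> ?rhs"
  proof (rule SUP_least)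
    fix Q assume "Q \<in> {Q \<in> prob_measures. OT_reg_div D c Q P < \<infinity>}"
    then obtain t where t: "OT_reg_div D c Q P = ennreal t" "0 \<le> t"
      by (cases "OT_reg_div D c Q P" rule: ennreal_cases) auto
    show "ereal_expect Q L - ereal lam * enn2ereal (OT_reg_div D c Q P) \<le> ?rhs"
    \<comment> \<open>The infima over \<eta> and \<pi> need not be attained, and the expectation of
      \<open>L\<close> may be infinite. Separating reals \<open>z\<close> and \<open>w\<close> turn
      the gap into a budget \<open>(w - z) / lam\<close>, strictly above \<open>t\<close>, that a
      suitable \<eta> and coupling respect together.\<close>
    proof (rule ccontr)
      assume "\<not> ?thesis"
      then have "?rhs < ereal_expect Q L - ereal (lam * t)" using t by (simp add: not_le)
      then obtain z where z: "?rhs < ereal z" "ereal z < ereal_expect Q L - ereal (lam * t)"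
        using ereal_dense2 by blast
      from z(2) have "ereal (z + lam * t) < ereal_expect Q L" by (simp add: ereal_less_minus)
      then obtain w where w: "z + lam * t < w" "ereal w < ereal_expect Q L"
        using ereal_dense2 by force
      have "t < (w - z) / lam" using w(1) lam_pos by (simp add: field_simps)
      then have "OT_reg_div D c Q P < ennreal ((w - z) / lam)"
        unfolding t(1) using t(2) by (simp add: ennreal_less_iff)
      then obtain \<eta> where \<eta>: "\<eta> \<in> prob_measures" "D \<eta> P + OT_cost c \<eta> Q < ennreal ((w - z) / lam)"
        unfolding OT_reg_div_def by (auto simp: INF_less_iff)
      then obtain d o' where d: "D \<eta> P = ennreal d" "0 \<le> d" and o': "OT_cost c \<eta> Q = ennreal o'" "0 \<le> o'"
        by (cases "D \<eta> P" rule: ennreal_cases; cases "OT_cost c \<eta> Q" rule: ennreal_cases) auto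
      have "d + o' < (w - z) / lam"
        using \<eta>(2) d o' by (simp add: ennreal_less_iff flip: ennreal_plus)
      then have "OT_cost c \<eta> Q < ennreal ((w - z) / lam - d)"
        using o' by (simp add: ennreal_less_iff)
      then obtain \<pi> where \<pi>: "\<pi> \<in> couplings \<eta> Q"
        "(\<integral>\<^sup>+ p. e2ennreal (c (fst p) (snd p)) \<partial>\<pi>) < ennreal ((w - z) / lam - d)"
        unfolding OT_cost_def by (auto simp: INF_less_iff)
      then obtain i where i: "(\<integral>\<^sup>+ p. e2ennreal (c (fst p) (snd p)) \<partial>\<pi>) = ennreal i" "0 \<le> i"
        by (cases "\<integral>\<^sup>+ p. e2ennreal (c (fst p) (snd p)) \<partial>\<pi>" rule: ennreal_cases) auto
      have "i < (w - z) / lam - d" using \<pi>(2) i by (simp add: ennreal_less_iff)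
      then have less: "z < w - lam * i - lam * d" using lam_pos by (simp add: field_simps)
      have \<pi>_sets: "sets \<pi> = sets borel" using \<pi>(1) by (simp add: couplings_def prob_measures_def)
      have "(\<lambda>p. e2ennreal (c (fst p) (snd p))) \<in> borel_measurable \<pi>"
        using c_meas by (simp add: measurable_cong_sets[OF \<pi>_sets refl])
      then have "(\<integral>\<^sup>+ p. k (fst p) (snd p) \<partial>\<pi>) = ennreal lam * ennreal i"
        unfolding k_def i(1)[symmetric] by (rule nn_integral_cmult)
      then have int_k: "(\<integral>\<^sup>+ p. k (fst p) (snd p) \<partial>\<pi>) = ennreal (lam * i)"
        using lam_pos i(2) by (simp add: ennreal_mult)
      have "ereal_expect Q L - enn2ereal (ennreal (lam * i)) \<le> ereal_expect \<eta> (cost_transform L k)"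
        unfolding int_k[symmetric]
        by (rule cost_transform_upper_bound[OF L_meas L_fin L_bdd k_meas \<pi>(1) \<eta>(1)]) (simp add: int_k)
      then have "ereal_expect Q L - ereal (lam * i) \<le> ereal_expect \<eta> (cost_transform L k)"
        using lam_pos i(2) by simp
      moreover have "ereal_expect \<eta> (cost_transform L k) - ereal (lam * d) \<le> ?rhs"
        by (rule SUP_upper2[of \<eta>]) (use \<eta>(1) d in \<open>auto simp: ereal_expect_completion transform_eq\<close>)
      ultimately have "ereal_expect Q L - ereal (lam * i) - ereal (lam * d) \<le> ?rhs"
        by (meson ereal_minus_mono order_refl order_trans)
      then have "ereal_expect Q L - ereal (lam * i) - ereal (lam * d) < ereal z"
        using z(1) by (rule le_less_trans)
      with w(2) less show False by (cases "ereal_expect Q L") auto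
    qed
  qed
  moreover have "?rhs \<le> ?lhs"
  proof (rule SUP_least)
    fix Q assume Q: "Q \<in> {Q \<in> prob_measures. D Q P < \<infinity>}"
    then obtain d where d: "D Q P = ennreal d" "0 \<le> d"
      by (cases "D Q P" rule: ennreal_cases) auto
    from Q have Q_sets: "sets Q = sets borel" and Q_prob: "prob_space Q" by (auto simp: prob_measures_def)
    have "ereal_expect Q (cost_transform L k) - ereal (lam * d) \<le> ?lhs"
    proof (rule dense_le)
      fix y assume "y < ereal_expect Q (cost_transform L k) - ereal (lam * d)"
      then have "y + ereal (lam * d) < ereal_expect Q (cost_transform L k)" by (simp add: ereal_less_minus)
      then obtain r where r: "y + ereal (lam * d) < ereal r" "ereal r < ereal_expect Q (cost_transform L k)"
        using ereal_dense2 by blast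
      have "\<exists>f\<in>borel_measurable borel. (\<integral>\<^sup>+ x. k x (f x) \<partial>Q) < \<infinity>
        \<and> ereal r < ereal_expect Q (\<lambda>x. L (f x)) - enn2ereal (\<integral>\<^sup>+ x. k x (f x) \<partial>Q)"
        using L_bdd near_optimal_selection_below[OF Q_prob Q_sets L_meas L_fin _ k_meas k_diag r(2)]
          near_optimal_selection_above[OF Q_prob Q_sets L_meas _ k_meas r(2)] by blast
      then obtain f where f: "f \<in> borel_measurable borel" and fin: "(\<integral>\<^sup>+ x. k x (f x) \<partial>Q) < \<infinity>"
        and less: "ereal r < ereal_expect Q (\<lambda>x. L (f x)) - enn2ereal (\<integral>\<^sup>+ x. k x (f x) \<partial>Q)"
        by blast
      have fQ: "f \<in> measurable Q borel" and graph: "(\<lambda>x. (x, f x)) \<in> measurable Q borel"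
        using f measurable_pair_graph[OF f] by (simp_all add: measurable_cong_sets[OF Q_sets refl])
      define \<nu> where "\<nu> = distr Q borel f"
      define \<pi> where "\<pi> = distr Q borel (\<lambda>x. (x, f x))"
      have \<nu>: "\<nu> \<in> prob_measures"
        using prob_space.prob_space_distr[OF Q_prob fQ] by (simp add: \<nu>_def prob_measures_def)
      have "\<pi> \<in> couplings Q \<nu>"
      proof -
        have fst_snd: "fst \<in> measurable (borel :: ('a \<times> 'a) measure) (borel :: 'a measure)"
          "snd \<in> measurable (borel :: ('a \<times> 'a) measure) (borel :: 'a measure)"
          by (intro borel_measurable_continuous_onI continuous_intros)+
        have "distr \<pi> borel fst = Q"
          unfolding \<pi>_def by (subst distr_distr[OF fst_snd(1) graph]) (simp add: o_def distr_id2 Q_sets)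
        moreover have "distr \<pi> borel snd = \<nu>"
          unfolding \<pi>_def \<nu>_def by (subst distr_distr[OF fst_snd(2) graph]) (simp add: o_def)
        ultimately show ?thesis
          using prob_space.prob_space_distr[OF Q_prob graph]
          by (simp add: couplings_def prob_measures_def \<pi>_def)
      qed
      then have "OT_cost c Q \<nu> \<le> (\<integral>\<^sup>+ p. e2ennreal (c (fst p) (snd p)) \<partial>\<pi>)"
        unfolding OT_cost_def by (rule INF_lower)
      also have "\<dots> = (\<integral>\<^sup>+ x. e2ennreal (c x (f x)) \<partial>Q)"
        unfolding \<pi>_def using c_meas by (subst nn_integral_distr[OF graph]) simp_all
      finally have OT: "OT_cost c Q \<nu> \<le> (\<integral>\<^sup>+ x. e2ennreal (c x (f x)) \<partial>Q)" .
      have int_k: "(\<integral>\<^sup>+ x. k x (f x) \<partial>Q) = ennreal lam * (\<integral>\<^sup>+ x. e2ennreal (c x (f x)) \<partial>Q)"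
        unfolding k_def using measurable_compose[OF graph c_meas] by (intro nn_integral_cmult) simp
      then obtain i where i: "(\<integral>\<^sup>+ x. e2ennreal (c x (f x)) \<partial>Q) = ennreal i" "0 \<le> i"
        using fin lam_pos
        by (cases "\<integral>\<^sup>+ x. e2ennreal (c x (f x)) \<partial>Q" rule: ennreal_cases) (auto simp: ennreal_mult_top)
      \<comment> \<open>The infimum over \<eta> is tested at \<open>Q\<close>. The resulting bound
        is finite, so \<nu> is admissible in the left supremum.\<close>
      have "OT_reg_div D c \<nu> P \<le> D Q P + OT_cost c Q \<nu>"
        unfolding OT_reg_div_def using Q by (intro INF_lower) simp
      also have "\<dots> \<le> ennreal (d + i)"
        using OT d i by (simp add: add_left_mono)
      finally have div_le: "OT_reg_div D c \<nu> P \<le> ennreal (d + i)" .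
      then obtain t where t: "OT_reg_div D c \<nu> P = ennreal t" "0 \<le> t" "t \<le> d + i"
        using d(2) i(2) by (cases "OT_reg_div D c \<nu> P" rule: ennreal_cases) (auto simp: top_unique ennreal_le_iff simp del: ennreal_plus)
      have expect_\<nu>: "ereal_expect \<nu> L = ereal_expect Q (\<lambda>x. L (f x))"
        unfolding \<nu>_def by (rule ereal_expect_distr[OF fQ L_meas])
      have "ereal r < ereal_expect \<nu> L - ereal (lam * i)"
        using less i lam_pos by (simp add: int_k expect_\<nu> flip: ennreal_mult)
      moreover have "lam * t \<le> lam * d + lam * i"
        using t(3) lam_pos by (simp flip: distrib_left)
      ultimately have "y < ereal_expect \<nu> L - ereal (lam * t)"
        using r(1) by (cases "ereal_expect \<nu> L"; cases y) auto
      also have "\<dots> \<le> ?lhs"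
        by (rule SUP_upper2[of \<nu>]) (use \<nu> t in auto)
      finally show "y \<le> ?lhs" by simp
    qed
    then show "ereal_expect (completion Q) (\<lambda>x. ereal lam * L_c L c lam x) - ereal lam * enn2ereal (D Q P) \<le> ?lhs"
      using d by (simp add: ereal_expect_completion transform_eq)
  qed
  ultimately show ?thesis by (simp add: antisym)
qed

end
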